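(* Let $u$ be a meromorphic function on $\mathbb{C}$ with poles at the points $a_1,a_2,\dots$, let $\varphi_{i,m}$ denote the coefficient of $(x-a_i)^m$ in the Laurent expansion of $u$ at $a_i$, and let $L_4=\partial_x^4+u(x)$. Suppose that $L_4$ commutes with a differential operator $M$ of order $4g+2$ and that $M$, $L_4$ are operators of rank $2$. Then: (a) every pole of $u$ in $\mathbb{C}$ has order exactly $4$; (b) for each pole $a_i$ there is $n_i\in\mathbb{N}$ with $\varphi_{i,-4}=n_i(4n_i+1)(4n_i+3)(4n_i+4)$; (c) $\varphi_{i,4k-l}=0$ for all $k=0,\dots,n_i$ and $l=1,2,3$; (d) $\varphi_{i,4r-1}=\varphi_{i,4r-3}=0$ for all $r=n_i+1,\dots,g$; (e) $u$ does not have an isolated pole at infinity.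
   Context: Differential operators are ordinary scalar linear differential operators in $x$ (with meromorphic coefficients); $\partial_x=d/dx$. If two such operators $L,M$ commute, there is a nonzero polynomial $R(z,w)$ with $R(L,M)=0$, and if $L\psi=z\psi$, $M\psi=w\psi$ with $\psi\ne0$ then $(z,w)$ lies on the spectral curve $R(z,w)=0$. The rank of the pair is the dimension of the space of common eigenfunctions $\{\psi: L\psi=z\psi,\ M\psi=w\psi\}$, which is the same for almost all points $(z,w)$ of the spectral curve. $\mathbb{N}=\{1,2,3,\dots\}$. "Isolated pole at infinity" means that $u$ is holomorphic for $|x|>R$ for some $R$ and has a pole at $x=\infty$. *)

theory Defs
  imports
    "HOL-Complex_Analysis.Complex_Analysis"
    "HOL-Computational_Algebra.Computational_Algebra"
    "HOL-Library.Function_Algebras"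
begin

text \<open>
  An operator \<open>\<Sum>i\<le>n. c\<^sub>i(x) \<partial>\<^sub>x^i\<close> is given by the list \<open>[c\<^sub>0, \<dots>, c\<^sub>n]\<close> of its coefficients.
  Meromorphic functions are represented by \<^const>\<open>nicely_meromorphic_on\<close> functions: these have
  no removable discontinuities and take the value 0 at their poles, so that distinct
  representatives are distinct meromorphic functions and \<open>c \<noteq> (\<lambda>_. 0)\<close> means that \<open>c\<close> does not
  vanish identically.
\<close>

type_synonym diff_op = "(complex \<Rightarrow> complex) list"

definition diff_op_of_order :: "diff_op \<Rightarrow> nat \<Rightarrow> bool" where
  "diff_op_of_order P n \<longleftrightarrow>
     length P = n + 1 \<and> (\<forall>c\<in>set P. c nicely_meromorphic_on UNIV) \<and> last P \<noteq> (\<lambda>_. 0)"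

definition diff_op_apply :: "diff_op \<Rightarrow> (complex \<Rightarrow> complex) \<Rightarrow> complex \<Rightarrow> complex" where
  "diff_op_apply P f x = (\<Sum>i<length P. (P ! i) x * (deriv ^^ i) f x)"

definition L4 :: "(complex \<Rightarrow> complex) \<Rightarrow> diff_op" where
  "L4 u = [u, \<lambda>_. 0, \<lambda>_. 0, \<lambda>_. 0, \<lambda>_. 1]"

lemma diff_op_apply_L4: "diff_op_apply (L4 u) f x = (deriv ^^ 4) f x + u x * f x"
  by (simp add: diff_op_apply_def L4_def lessThan_Suc eval_nat_numeral)

lemma diff_op_of_order_L4:
  "u nicely_meromorphic_on UNIV \<Longrightarrow> diff_op_of_order (L4 u) 4"
  by (auto simp: diff_op_of_order_def L4_def fun_eq_iff)

text \<open>
  The points at which the equation \<open>P \<psi> = z \<psi>\<close> is regular: no coefficient has a pole there and the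
  leading coefficient does not vanish.
\<close>

definition regular_points :: "diff_op \<Rightarrow> complex set" where
  "regular_points P = {x. (\<forall>c\<in>set P. \<not> is_pole c x) \<and> last P x \<noteq> 0}"

text \<open>
  Equality of operators is tested on all functions holomorphic on an open set of regular points.
  (As a discrete set of points is left out, this is the same as equality of the coefficients as
  meromorphic functions.)
\<close>

definition op_eq_on ::
  "complex set \<Rightarrow> ((complex \<Rightarrow> complex) \<Rightarrow> complex \<Rightarrow> complex)
    \<Rightarrow> ((complex \<Rightarrow> complex) \<Rightarrow> complex \<Rightarrow> complex) \<Rightarrow> bool" where
  "op_eq_on S A B \<longleftrightarrow>
     (\<forall>U f. open U \<longrightarrow> U \<subseteq> S \<longrightarrow> f holomorphic_on U \<longrightarrow> (\<forall>x\<in>U. A f x = B f x))"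

definition diff_op_commute :: "diff_op \<Rightarrow> diff_op \<Rightarrow> bool" where
  "diff_op_commute L M \<longleftrightarrow>
     op_eq_on (regular_points L \<inter> regular_points M)
       (\<lambda>f. diff_op_apply L (diff_op_apply M f)) (\<lambda>f. diff_op_apply M (diff_op_apply L f))"

text \<open>
  A polynomial \<open>R(z,w) = \<Sum>i j. r\<^sub>i\<^sub>j z^j w^i\<close> is a \<^typ>\<open>complex poly poly\<close>, with \<open>z\<close> the inner and \<open>w\<close>
  the outer variable: \<open>r\<^sub>i\<^sub>j = coeff (coeff R i) j\<close>.
\<close>

definition poly2 :: "complex poly poly \<Rightarrow> complex \<Rightarrow> complex \<Rightarrow> complex" where
  "poly2 R z w = poly (poly R [:w:]) z"

definition poly2_op ::
  "complex poly poly \<Rightarrow> diff_op \<Rightarrow> diff_op \<Rightarrow> (complex \<Rightarrow> complex) \<Rightarrow> complex \<Rightarrow> complex" where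
  "poly2_op R L M f x =
     (\<Sum>i\<le>degree R. \<Sum>j\<le>degree (coeff R i).
        coeff (coeff R i) j * (diff_op_apply L ^^ j) ((diff_op_apply M ^^ i) f) x)"

definition annihilates :: "complex poly poly \<Rightarrow> diff_op \<Rightarrow> diff_op \<Rightarrow> bool" where
  "annihilates R L M \<longleftrightarrow>
     op_eq_on (regular_points L \<inter> regular_points M) (poly2_op R L M) (\<lambda>f x. 0)"

definition cfun_scale :: "complex \<Rightarrow> (complex \<Rightarrow> complex) \<Rightarrow> complex \<Rightarrow> complex" where
  "cfun_scale c f = (\<lambda>x. c * f x)"

lemma vector_space_cfun_scale: "vector_space cfun_scale"
  by unfold_locales (auto simp: cfun_scale_def fun_eq_iff algebra_simps)

text \<open>
  Eigenfunctions are in general multivalued on the complement of the singular points, so they are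
  taken on an open set \<open>U\<close> (below: a disc of regular points). A function on \<open>U\<close> is represented by
  its extension by 0.
\<close>

definition common_eigenspace ::
  "complex set \<Rightarrow> diff_op \<Rightarrow> diff_op \<Rightarrow> complex \<Rightarrow> complex \<Rightarrow> (complex \<Rightarrow> complex) set" where
  "common_eigenspace U L M z w =
     {\<psi>. \<psi> holomorphic_on U \<and> (\<forall>x. x \<notin> U \<longrightarrow> \<psi> x = 0) \<and>
         (\<forall>x\<in>U. diff_op_apply L \<psi> x = z * \<psi> x \<and> diff_op_apply M \<psi> x = w * \<psi> x)}"

text \<open>
  \<open>L\<close> and \<open>M\<close> have rank \<open>r\<close>: for all but finitely many points of the spectral curve \<open>R(z,w) = 0\<close> the
  common eigenfunctions form a space of complex dimension \<open>r\<close>. For \<open>r > 0\<close> this forces \<open>R\<close> to have no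
  superfluous components: there are no common eigenfunctions at the points of a component that does
  not belong to every curve \<open>R'(z,w) = 0\<close> with \<open>R'(L,M) = 0\<close>, apart from finitely many points.
  By analytic continuation, the dimension does not depend on the disc.
\<close>

definition has_rank :: "diff_op \<Rightarrow> diff_op \<Rightarrow> nat \<Rightarrow> bool" where
  "has_rank L M r \<longleftrightarrow>
     (\<exists>R. R \<noteq> 0 \<and> annihilates R L M \<and>
        (\<forall>x\<^sub>0 \<rho>. \<rho> > 0 \<longrightarrow> ball x\<^sub>0 \<rho> \<subseteq> regular_points L \<inter> regular_points M \<longrightarrow>
           finite {(z, w). poly2 R z w = 0 \<and>
             vector_space.dim cfun_scale (common_eigenspace (ball x\<^sub>0 \<rho>) L M z w) \<noteq> r}))"

definition laurent_coeff :: "(complex \<Rightarrow> complex) \<Rightarrow> complex \<Rightarrow> int \<Rightarrow> complex" where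
  "laurent_coeff f a m = fls_nth (laurent_expansion f a) m"

definition isolated_pole_at_infinity :: "(complex \<Rightarrow> complex) \<Rightarrow> bool" where
  "isolated_pole_at_infinity f \<longleftrightarrow>
     (\<exists>R. f holomorphic_on {x. norm x > R}) \<and> is_pole (\<lambda>t. f (inverse t)) 0"

end

theory Submission
  imports Defs
begin

text \<open>
  Write \<open>L\<close> for the operator \<open>\<partial>\<^sup>4 + u\<close>. An operator \<open>M\<close> that commutes with \<open>L\<close> maps solutions of
  \<open>L \<psi> = z \<psi>\<close> to solutions, so on such a \<open>\<psi>\<close> it acts as
  \<open>b\<^sub>0 \<psi> + b\<^sub>1 \<psi>' + b\<^sub>2 \<psi>'' + b\<^sub>3 \<psi>'''\<close> with coefficients that are polynomials in \<open>z\<close> and satisfy a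
  linear system of differential equations in \<open>x\<close>. This system implies a single equation for
  \<open>Q = 2 b\<^sub>2 + b\<^sub>3'\<close>, namely \<open>Q\<^sup>(\<^sup>5\<^sup>) + 4 (z - u) Q' - 2 u' Q = 0\<close>. As \<open>M\<close> has order \<open>4g + 2\<close>, the degree
  of \<open>Q\<close> in \<open>z\<close> is \<open>g\<close> and its leading coefficient is constant. After normalisation the coefficients
  \<open>a\<^sub>i\<close> of \<open>z\<^sup>g\<^sup>-\<^sup>i\<close> in \<open>Q\<close> satisfy \<open>a\<^sub>0 = 1\<close>, \<open>a\<^sub>i = 0\<close> for \<open>i > g\<close> and
  \<open>4 a\<^sub>i\<^sub>+\<^sub>1' = 4 u a\<^sub>i' + 2 u' a\<^sub>i - a\<^sub>i\<^sup>(\<^sup>5\<^sup>)\<close> (lemma \<open>lax_recursion_at\<close>). All statements about \<open>u\<close> follow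
  from the fact that this recursion terminates.

  At a pole of order greater than 4 the leading terms of the \<open>a\<^sub>i\<close> never vanish. So the order is at
  most 4. Let \<open>\<phi>\<close> be the coefficient of \<open>x\<^sup>-\<^sup>4\<close> in \<open>u\<close>. The coefficient of \<open>x\<^sup>-\<^sup>4\<^sup>i\<close> in \<open>a\<^sub>i\<close> is
  multiplied in each step by a multiple of \<open>\<phi> - h(i)\<close> with \<open>h(i) = i (4i+1) (4i+3) (4i+4)\<close>, and
  termination forces \<open>\<phi> = h(n)\<close> for some \<open>n\<close> (lemma \<open>lax_leading_coefficient\<close>). Next, let \<open>m\<close> be the
  first exponent of \<open>u\<close> that is odd, or the first that is not divisible by 4. It disturbs \<open>a\<^sub>i\<close> first
  at \<open>x\<^sup>m\<^sup>+\<^sup>4\<^sup>-\<^sup>4\<^sup>i\<close>, and the coefficients there satisfy an inhomogeneous two-term recursion in \<open>i\<close>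
  (lemma \<open>lax_first_perturbation\<close>). If the solution of this recursion is nonzero for all large \<open>i\<close>,
  then the exponent \<open>m\<close> cannot occur.

  For \<open>m < 0\<close> and for \<open>m = 4k - 2\<close> with \<open>1 \<le> k \<le> n\<close> a look at the signs is enough. For odd \<open>m\<close>
  variation of constants expresses the solution by a terminating very-well-poised hypergeometric
  sum whose terms do not have a common sign. Whipple's transformation turns it into a balanced
  sum in which the terms are first positive and then alternate with decreasing absolute values. So
  it is positive up to a nonzero factor (lemma \<open>wp_sum_nonzero\<close>). In the case \<open>n = 0\<close> all
  coefficients of \<open>u\<close> with negative exponent vanish, so at a pole \<open>n \<ge> 1\<close>.

  At infinity the equation for \<open>Q\<close> is integrated once. The expression
  \<open>4 (z - u) Q\<^sup>2 + Q''\<^sup>2 - 2 Q' Q''' + 2 Q Q''''\<close> does not depend on \<open>x\<close>, and its coefficients determine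
  each \<open>a\<^sub>k\<close> as a differential polynomial in \<open>u\<close>. If \<open>u\<close> grew like \<open>c x\<^sup>n\<close>, then \<open>a\<^sub>k\<close> would grow like
  \<open>\<gamma>\<^sub>k c\<^sup>k x\<^sup>n\<^sup>k\<close>, where \<open>\<gamma>\<^sub>k \<noteq> 0\<close> are the coefficients of \<open>(1 - y)\<^sup>-\<^sup>1\<^sup>/\<^sup>2\<close>. Hence the coefficient of
  \<open>z\<^sup>0\<close> in the first integral would grow like \<open>x\<^sup>n\<^sup>(\<^sup>2\<^sup>g\<^sup>+\<^sup>1\<^sup>)\<close>, although it is constant.
\<close>

section \<open>Positivity of a very-well-poised sum\<close>

lemma pochhammer_shift: "pochhammer (x::'a::comm_ring_1) k * (x + of_nat k) = x * pochhammer (x + 1) k"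
  by (metis pochhammer_Suc pochhammer_rec)

text \<open>
  Horner's scheme from the last term: the tail that starts at index \<open>k\<close> is \<open>z k\<close> times a factor \<open>h\<close>.
  In the range of ratios in \<open>(-1, 0]\<close> this factor stays in \<open>(0, 1]\<close>, and a ratio \<open>\<ge> 0\<close> keeps it
  positive.
\<close>
lemma alternating_sum_pos:
  fixes z r :: "nat \<Rightarrow> real" and s :: real
  assumes z: "\<And>k. k < n \<Longrightarrow> z (Suc k) = r k * z k" and z0: "z 0 > 0"
    and r1: "\<And>k. k < n \<Longrightarrow> real k \<le> s \<Longrightarrow> r k \<ge> 0"
    and r2: "\<And>k. k < n \<Longrightarrow> real k \<ge> s \<Longrightarrow> -1 < r k \<and> r k \<le> 0"
  shows "(\<Sum>k\<le>n. z k) > 0"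
proof -
  have "\<exists>h. (\<Sum>j=k..n. z j) = z k * h \<and> h > 0 \<and> (real k \<ge> s \<longrightarrow> h \<le> 1)" if "k + d = n" for k d
    using that
  proof (induction d arbitrary: k)
    case 0
    then show ?case by (intro exI[of _ 1]) auto
  next
    case (Suc d)
    from Suc.prems have "Suc k + d = n" by simp
    from Suc.IH[OF this] obtain h where h: "(\<Sum>j=Suc k..n. z j) = z (Suc k) * h" "h > 0" "real (Suc k) \<ge> s \<longrightarrow> h \<le> 1" by blast
    have kn: "k < n" using Suc.prems by simp
    have eq: "(\<Sum>j=k..n. z j) = z k * (1 + r k * h)"
      using h(1) z[OF kn] kn by (simp add: sum.atLeast_Suc_atMost algebra_simps)
    show ?case
    proof (cases "real k \<le> s \<and> real k \<noteq> s")
      case True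
      then show ?thesis using eq r1[OF kn] h(2) 
        by (intro exI[of _ "1 + r k * h"]) (auto intro: add_pos_nonneg)
    next
      case False
      then have ks: "real k \<ge> s" by auto
      then have "h \<le> 1" using h(3) by simp
      have "-1 < r k" "r k \<le> 0" using r2[OF kn ks] by auto
      then have "(- r k) * h < 1" using \<open>h \<le> 1\<close> \<open>h > 0\<close>
        by (smt (verit) mult_left_le)
      moreover have "r k * h \<le> 0" using \<open>r k \<le> 0\<close> \<open>h > 0\<close> by (simp add: mult_nonpos_nonneg)
      ultimately show ?thesis using eq by (intro exI[of _ "1 + r k * h"]) auto
    qed
  qed
  from this[of 0 n] obtain h where "(\<Sum>j=0..n. z j) = z 0 * h" "h > 0" by auto
  then show ?thesis using z0 by (simp add: atMost_atLeast0)
qed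

text \<open>
  The product of the Pochhammer symbols of \<open>x + \<i> \<surd>y\<close> and \<open>x - \<i> \<surd>y\<close>, kept real.
\<close>
definition square_prod :: "real \<Rightarrow> real \<Rightarrow> nat \<Rightarrow> real" where
  "square_prod y x k = (\<Prod>j<k. (x + real j)\<^sup>2 + y)"

lemma square_prod_0 [simp]: "square_prod y x 0 = 1"
  and square_prod_Suc: "square_prod y x (Suc k) = square_prod y x k * ((x + real k)\<^sup>2 + y)"
  by (simp_all add: square_prod_def)

lemma square_prod_pos: "y > 0 \<Longrightarrow> square_prod y x k > 0"
  unfolding square_prod_def by (intro prod_pos) (auto intro: add_nonneg_pos)

text \<open>
  Saalschuetz's summation of a balanced \<open>\<^sub>3F\<^sub>2\<close> with a pair of conjugate parameters, by the method of
  Wilf and Zeilberger: the recursion in \<open>i\<close> of the right-hand side holds for the summand up to a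
  difference \<open>G (k + 1) - G k\<close>. Terms with \<open>k > i\<close> vanish. The common bound \<open>n\<close> makes the double
  sum in the later application run over a square.
\<close>
lemma saalschuetz:
  fixes a y :: real
  assumes y: "y > 0" and a: "\<And>j::nat. a + real j \<noteq> 0" and "i \<le> n"
  shows "(\<Sum>k\<le>n. pochhammer a k * pochhammer (a + real i) k * pochhammer (- real i) k /
            (fact k * square_prod y (a + 1/2) k)) = square_prod y (1/2) i / square_prod y (a + 1/2) i"
  using \<open>i \<le> n\<close>
proof (induction i)
  case 0
  have "(\<Sum>k\<le>n. pochhammer a k * pochhammer (a + real 0) k * pochhammer (- real 0) k /
            (fact k * square_prod y (a + 1/2) k)) = (\<Sum>k\<in>{0::nat}. 1)"
    by (rule sum.mono_neutral_cong_right) (auto simp: pochhammer_0_left)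
  then show ?case by simp
next
  case (Suc i)
  define B where "B = square_prod y (a + 1/2)"
  have Bpos: "B k > 0" for k unfolding B_def using y by (rule square_prod_pos)
  have BS: "B (Suc k) = B k * ((a + 1/2 + real k)\<^sup>2 + y)" for k by (simp add: B_def square_prod_Suc)
  define A where "A = square_prod y (1/2)"
  have Apos: "A k > 0" for k unfolding A_def using y by (rule square_prod_pos)
  have AS: "A (Suc k) = A k * ((1/2 + real k)\<^sup>2 + y)" for k by (simp add: A_def square_prod_Suc)
  define F where "F = (\<lambda>i k. pochhammer a k * pochhammer (a + real i) k * pochhammer (- real i) k / (fact k * B k))"
  define ai where "ai = (1/2 + real i)\<^sup>2 + y"
  define bi where "bi = (a + 1/2 + real i)\<^sup>2 + y"
  have ai: "ai > 0" and bi: "bi > 0" unfolding ai_def bi_def using y by (auto intro: add_nonneg_pos)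
  \<comment> \<open>The certificate. It vanishes at \<open>k = 0\<close>, and at \<open>k = n + 1\<close> because \<open>i < n\<close>.\<close>
  define G where "G = (\<lambda>k. case k of 0 \<Rightarrow> 0 | Suc k \<Rightarrow>
     (2 * real i + 1 + a) / (real i + a) * (real k + a) * (real i + a + real k) * F i k)"
  have iap: "real i + a \<noteq> 0" using a[of i] by (simp add: add.commute)
  have step: "bi * F (Suc i) k - ai * F i k = G (Suc k) - G k" for k
  proof (cases k)
    case 0
    then show ?thesis using iap
      by (simp add: G_def F_def B_def ai_def bi_def field_simps power2_eq_square)
  next
    case (Suc k')
    define P1 P2 P3 where "P1 = pochhammer a k'" and "P2 = pochhammer (a + real i) k'" and "P3 = pochhammer (- real i) k'"
    define bk where "bk = (a + 1/2 + real k')\<^sup>2 + y"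
    have bk: "bk > 0" unfolding bk_def using y by (auto intro: add_nonneg_pos)
    have p2: "(real i + a) * pochhammer (a + real (Suc i)) (Suc k') = P2 * (a + real i + real k') * (a + real i + real k' + 1)"
    proof -
      have "(a + real i) * pochhammer (a + real i + 1) (Suc k') = pochhammer (a + real i) (Suc (Suc k'))"
        by (simp add: pochhammer_rec)
      then show ?thesis by (simp add: P2_def pochhammer_Suc algebra_simps)
    qed
    have p3: "pochhammer (- real (Suc i)) (Suc k') = (- real (Suc i)) * P3"
      by (simp add: P3_def pochhammer_rec)
    have e1: "F (Suc i) k = P1 * (a + real k') * (P2 * (a + real i + real k') * (a + real i + real k' + 1) / (real i + a)) * (- real (Suc i) * P3) / (fact k' * (1 + real k') * (B k' * bk))"
    proof -
      have q: "pochhammer (a + real (Suc i)) (Suc k') = P2 * (a + real i + real k') * (a + real i + real k' + 1) / (real i + a)"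
        using p2 iap by (metis nonzero_mult_div_cancel_left)
      have r: "B (Suc k') = B k' * bk" by (simp add: BS bk_def)
      show ?thesis unfolding F_def Suc p3 q r by (simp add: P1_def pochhammer_Suc)
    qed
    have e2: "F i k = P1 * (a + real k') * (P2 * (a + real i + real k')) * (P3 * (real k' - real i)) / (fact k' * (1 + real k') * (B k' * bk))"
    proof -
      have r: "B (Suc k') = B k' * bk" by (simp add: BS bk_def)
      show ?thesis unfolding F_def Suc r by (simp add: P1_def P2_def P3_def pochhammer_Suc)
    qed
    have e3: "F i k' = P1 * P2 * P3 / (fact k' * B k')"
      unfolding F_def by (simp add: P1_def P2_def P3_def)
    define W where "W = P1 * P2 * P3 / (fact k' * B k')"
    have k1: "1 + real k' \<noteq> 0" by linarith
    have rearr1: "p1 * c1 * (p2 * c2 * c3 / p) * (c4 * p3) / (f * k * (b * q)) = p1 * p2 * p3 / (f * b) * (c1 * c2 * c3 * c4 / (p * k * q))"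
      and rearr2: "p1 * c1 * (p2 * c2) * (p3 * c3) / (f * k * (b * q)) = p1 * p2 * p3 / (f * b) * (c1 * c2 * c3 / (k * q))"
      for p1 p2 p3 c1 c2 c3 c4 p f k b q :: real
      by (simp_all add: divide_inverse mult_ac)
    have w1: "F (Suc i) k = W * ((a + real k') * (a + real i + real k') * (a + real i + real k' + 1) * (- real i - 1) / ((real i + a) * (1 + real k') * bk))"
      proof -
      have "- real (Suc i) = - real i - 1" by simp
      then show ?thesis unfolding e1 W_def rearr1 by (simp only:)
    qed
    have w2: "F i k = W * ((a + real k') * (a + real i + real k') * (real k' - real i) / ((1 + real k') * bk))"
      unfolding e2 W_def rearr2 ..
    have "G (Suc k) - G k = W * ((2 * real i + 1 + a) / (real i + a) * ((real k' + 1 + a) * (real i + a + real k' + 1) * ((a + real k') * (a + real i + real k') * (real k' - real i) / ((1 + real k') * bk)) - (real k' + a) * (real i + a + real k')))"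
    proof -
      have gS: "G (Suc k) = (2 * real i + 1 + a) / (real i + a) * (real k' + 1 + a) * (real i + a + real k' + 1) * F i k"
        by (simp add: G_def Suc add_ac)
      have gk: "G k = (2 * real i + 1 + a) / (real i + a) * (real k' + a) * (real i + a + real k') * F i k'"
        by (simp add: G_def Suc)
      have rearr3: "c * x1 * x2 * (w * z) - c * u * v * w = w * (c * (x1 * x2 * z - u * v))" for c x1 x2 w z u v :: real
        by (simp add: algebra_simps)
      show ?thesis unfolding gS gk w2 e3 W_def[symmetric] rearr3 ..
    qed
    moreover have "bi * ((a + real k') * (a + real i + real k') * (a + real i + real k' + 1) * (- real i - 1) / ((real i + a) * (1 + real k') * bk))
       - ai * ((a + real k') * (a + real i + real k') * (real k' - real i) / ((1 + real k') * bk))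
       = (2 * real i + 1 + a) / (real i + a) * ((real k' + 1 + a) * (real i + a + real k' + 1) * ((a + real k') * (a + real i + real k') * (real k' - real i) / ((1 + real k') * bk)) - (real k' + a) * (real i + a + real k'))"
    proof -
      have core: "bi * ((a + real i + real k' + 1) * (- real i - 1)) - ai * (real i + a) * (real k' - real i)
       = (2 * real i + 1 + a) * ((real k' + 1 + a) * (real i + a + real k' + 1) * (real k' - real i) - (1 + real k') * bk)"
        unfolding bi_def ai_def bk_def by (simp add: power2_eq_square field_simps)
      have expand: "b * (u * v * w * z) - A * p * (u * v * s) = c * (r * t * (u * v * s) - k * b' * u * v)"
        if "b * (w * z) - A * p * s = c * (r * t * s - k * b')" for b u v w z A p s c r t k b' :: real
      proof -
        have "(b * (w * z) - A * p * s) * (u * v) = c * (r * t * s - k * b') * (u * v)" using that by simp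
        then show ?thesis by (simp add: algebra_simps)
      qed
      have main: "bi * ((a + real k') * (a + real i + real k') * (a + real i + real k' + 1) * (- real i - 1))
       - ai * (real i + a) * ((a + real k') * (a + real i + real k') * (real k' - real i))
       = (2 * real i + 1 + a) * ((real k' + 1 + a) * (real i + a + real k' + 1) * ((a + real k') * (a + real i + real k') * (real k' - real i)) - (1 + real k') * bk * (real k' + a) * (real i + a + real k'))"
        using expand[OF core, of "a + real k'" "a + real i + real k'"] by (simp only: add_ac)
      have gen: "bi * (x1 / (p * q * r)) - ai * (x2 / (q * r)) = c / p * (x3 * (x2 / (q * r)) - x4)"
        if "bi * x1 - ai * p * x2 = c * (x3 * x2 - q * r * x4)" "p \<noteq> 0" "q \<noteq> 0" "r \<noteq> 0" for x1 x2 x3 x4 p q r c :: real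
        using that by (simp add: field_simps)
      show ?thesis
        by (rule gen) (use main iap k1 bk in \<open>simp_all add: mult.assoc\<close>)
    qed
    moreover have "b * (w * x) - c * (w * z) = w * (b * x - c * z)" for b c w x z :: real
      by (simp add: algebra_simps)
    ultimately show ?thesis unfolding w1 by (simp only: w2)
  qed
  have "bi * (\<Sum>k\<le>n. F (Suc i) k) - ai * (\<Sum>k\<le>n. F i k) = (\<Sum>k\<le>n. G (Suc k) - G k)"
    by (simp add: sum_distrib_left sum_subtractf flip: step)
  also have "\<dots> = G (Suc n) - G 0"
    using sum_lessThan_telescope[of G "Suc n"] by (simp only: lessThan_Suc_atMost)
  also have "\<dots> = 0"
    using Suc.prems by (simp add: G_def F_def pochhammer_of_nat_eq_0_iff)
  finally have "bi * (\<Sum>k\<le>n. F (Suc i) k) = ai * (A i / B i)"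
    using Suc unfolding F_def A_def B_def by simp
  then have "(\<Sum>k\<le>n. F (Suc i) k) = A (Suc i) / B (Suc i)"
    using bi Bpos[of i] unfolding AS BS ai_def[symmetric] bi_def[symmetric] by (simp add: field_simps)
  then show ?case unfolding F_def A_def B_def .
qed


text \<open>
  The very-well-poised hypergeometric term with parameters \<open>a; 1/2, n + 1, -n\<close> is \<open>a + 2i\<close> times
  this one, up to the constant \<open>a\<close>.
\<close>
definition wp_coeff :: "nat \<Rightarrow> real \<Rightarrow> nat \<Rightarrow> real" where
  "wp_coeff n a i = pochhammer a i * pochhammer (1/2) i * pochhammer (- real n) i * pochhammer (real n + 1) i /
     (fact i * pochhammer (a + 1/2) i * pochhammer (a + real n + 1) i * pochhammer (a - real n) i)"

lemma wp_coeff_0 [simp]: "wp_coeff n a 0 = 1" by (simp add: wp_coeff_def)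

lemma wp_coeff_Suc:
  "wp_coeff n a (Suc i) = wp_coeff n a i * ((a + real i) * (1/2 + real i) * (real i - real n) * (real n + 1 + real i) /
     ((1 + real i) * (a + 1/2 + real i) * (a + real n + 1 + real i) * (a - real n + real i)))"
  unfolding wp_coeff_def by (simp add: pochhammer_Suc mult_ac)

text \<open>
  The inner sums that appear when \<open>saalschuetz\<close> is inserted in the sum of \<open>wp_sum_nonzero\<close> and the
  order of summation is exchanged.
\<close>
definition wp_moment :: "nat \<Rightarrow> real \<Rightarrow> nat \<Rightarrow> real" where
  "wp_moment n a k = (\<Sum>i\<le>n. (a + 2 * real i) * wp_coeff n a i * (pochhammer (a + real i) k * pochhammer (- real i) k))"

text \<open>
  The combination of the two summands is \<open>C (i + 1) - C i\<close>, and \<open>C\<close> vanishes at both ends: at 0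
  because of \<open>pochhammer 0 k\<close> (for \<open>k = 0\<close>, because of the factor \<open>k - i\<close>) and at \<open>n + 1\<close> because
  of the factor \<open>i - n\<close>.
\<close>
lemma wp_moment_Suc:
  assumes a: "\<And>j::int. a \<noteq> of_int j" "\<And>j::int. a + 1/2 \<noteq> of_int j"
  shows "(real k + 3/2 - a) * wp_moment n a (Suc k) = (real k + 1/2) * (real n + 1 + real k) * (real k - real n) * wp_moment n a k"
proof -
  define X where "X = (\<lambda>i. wp_coeff n a i * (pochhammer (a + real i) k * pochhammer (- real i) k))"
  define C where "C = (\<lambda>i. (real k - real i) * (a + real i - 1/2) * (a + real n + real i) * (a + real i - real n - 1) * X i)"
  have CS: "C (Suc i) = - (real i + 1/2) * (real i - real n) * (real i + real n + 1) * (real i + a + real k) * X i" for i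
  proof -
    define P N where "P = pochhammer (a + real i) k" and "N = pochhammer (- real (Suc i)) k"
    have n1: "a + real i \<noteq> 0" using a(1)[of "- int i"] by auto
    have n2: "a + 1/2 + real i \<noteq> 0" using a(2)[of "- int i"] by auto
    have n3: "a + real n + 1 + real i \<noteq> 0" using a(1)[of "- int i - 1 - int n"] by auto
    have n4: "a - real n + real i \<noteq> 0" using a(1)[of "- int i + int n"] by auto
    have p1: "pochhammer (a + real (Suc i)) k = P * (a + real i + real k) / (a + real i)"
      using pochhammer_shift[of "a + real i" k] n1 by (simp add: P_def field_simps)
    have p2: "pochhammer (- real i) k = N * (real k - real i - 1) / (- (1 + real i))"
      using pochhammer_shift[of "- real (Suc i)" k] by (simp add: N_def field_simps)
    have gen: "u1 * v2 * v3 * v4 * (w * (a1 * h * b * c / (d * v2 * v3 * v4)) * (P * q / a1 * N)) = - h * b * c * q * (w * (P * (N * u1 / (- d))))"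
      if "a1 \<noteq> 0" "v2 \<noteq> 0" "v3 \<noteq> 0" "v4 \<noteq> 0" "d \<noteq> 0" for u1 v2 v3 v4 w a1 h b c d P q N :: real
      using that by (simp add: field_simps)
    have e: "real k - real (Suc i) = real k - real i - 1" "a + real (Suc i) - 1/2 = a + 1/2 + real i"
      "a + real n + real (Suc i) = a + real n + 1 + real i" "a + real (Suc i) - real n - 1 = a - real n + real i"
      by simp_all
    have d: "1 + real i \<noteq> 0" by linarith
    have "C (Suc i) = - (1/2 + real i) * (real i - real n) * (real n + 1 + real i) * (a + real i + real k) * (wp_coeff n a i * (P * (N * (real k - real i - 1) / (- (1 + real i)))))"
      unfolding C_def X_def wp_coeff_Suc p1 N_def[symmetric] e
      by (rule gen[OF n1 n2 n3 n4 d])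
    then show ?thesis unfolding X_def p2 P_def[symmetric] by (simp add: add_ac)
  qed
  have C0: "C 0 = 0" by (cases k) (simp_all add: C_def X_def pochhammer_rec)
  have "(real k + 3/2 - a) * wp_moment n a (Suc k) - (real k + 1/2) * (real n + 1 + real k) * (real k - real n) * wp_moment n a k
     = (\<Sum>i\<le>n. C (Suc i) - C i)"
    unfolding wp_moment_def sum_distrib_left sum_subtractf[symmetric]
  proof (rule sum.cong[OF refl])
    fix i
    have e: "(real k + 3/2 - a) * ((a + 2 * real i) * w * (P * (a + real i + real k) * (N * (- real i + real k)))) -
        (real k + 1/2) * (real n + 1 + real k) * (real k - real n) * ((a + 2 * real i) * w * (P * N)) =
        - (real i + 1/2) * (real i - real n) * (real i + real n + 1) * (real i + a + real k) * (w * (P * N)) -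
        (real k - real i) * (a + real i - 1/2) * (a + real n + real i) * (a + real i - real n - 1) * (w * (P * N))" for w P N
    proof -
      have "(real k + 3/2 - a) * ((a + 2 * real i) * ((a + real i + real k) * (- real i + real k))) -
        (real k + 1/2) * (real n + 1 + real k) * (real k - real n) * (a + 2 * real i) =
        - (real i + 1/2) * (real i - real n) * (real i + real n + 1) * (real i + a + real k) -
        (real k - real i) * (a + real i - 1/2) * (a + real n + real i) * (a + real i - real n - 1)"
        by (simp add: field_simps)
      then have "((real k + 3/2 - a) * ((a + 2 * real i) * ((a + real i + real k) * (- real i + real k))) -
        (real k + 1/2) * (real n + 1 + real k) * (real k - real n) * (a + 2 * real i)) * (w * (P * N)) =
        (- (real i + 1/2) * (real i - real n) * (real i + real n + 1) * (real i + a + real k) -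
        (real k - real i) * (a + real i - 1/2) * (a + real n + real i) * (a + real i - real n - 1)) * (w * (P * N))"
        by (rule arg_cong)
      then show ?thesis unfolding left_diff_distrib[where c = "w * (P * N)"] by (simp only: mult_ac)
    qed
    show "(real k + 3 / 2 - a) * ((a + 2 * real i) * wp_coeff n a i * (pochhammer (a + real i) (Suc k) * pochhammer (- real i) (Suc k))) -
         (real k + 1 / 2) * (real n + 1 + real k) * (real k - real n) *
         ((a + 2 * real i) * wp_coeff n a i * (pochhammer (a + real i) k * pochhammer (- real i) k)) =
         C (Suc i) - C i"
      unfolding CS unfolding C_def X_def pochhammer_Suc by (rule e)
  qed
  also have "\<dots> = C (Suc n) - C 0"
    using sum_lessThan_telescope[of C "Suc n"] by (simp only: lessThan_Suc_atMost)
  also have "\<dots> = 0" unfolding CS C0 by simp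
  finally show ?thesis by simp
qed

text \<open>
  The recursion in \<open>k\<close> would carry a zero at \<open>k = 0\<close> up to \<open>k = n\<close>, but there only the term with
  \<open>i = n\<close> survives, and it is nonzero.
\<close>
lemma wp_moment_0_nonzero:
  assumes a: "\<And>j::int. a \<noteq> of_int j" "\<And>j::int. a + 1/2 \<noteq> of_int j" and "a \<le> 3/4"
  shows "wp_moment n a 0 \<noteq> 0"
proof
  assume "wp_moment n a 0 = 0"
  have "wp_moment n a k = 0" for k
  proof (induction k)
    case (Suc k)
    then have "(real k + 3/2 - a) * wp_moment n a (Suc k) = 0" using wp_moment_Suc[OF a, of k n] by simp
    moreover have "real k + 3/2 - a \<noteq> 0" using \<open>a \<le> 3/4\<close> by linarith
    ultimately show ?case by simp
  qed fact
  then have "wp_moment n a n = 0" .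
  moreover have "wp_moment n a n = (\<Sum>i\<in>{n}. (a + 2 * real i) * wp_coeff n a i * (pochhammer (a + real i) n * pochhammer (- real i) n))"
    unfolding wp_moment_def by (rule sum.mono_neutral_right) (auto simp: pochhammer_of_nat_eq_0_iff)
  moreover have "pochhammer x j \<noteq> 0" if "\<And>j::int. x \<noteq> of_int j" for x :: real and j
    using that unfolding pochhammer_eq_0_iff by (metis of_int_minus of_int_of_nat_eq)
  note nz = this
  have nzs: "x + 1/2 \<noteq> of_int j" "x + real l \<noteq> of_int j" "x - real l \<noteq> of_int j" "x + 2 * real l \<noteq> of_int j" "x + real l + 1 \<noteq> of_int j" 
    if "\<And>j::int. x \<noteq> of_int j" "\<And>j::int. x + 1/2 \<noteq> of_int j" for x :: real and l and j :: int
    using that(2)[of j] that(1)[of "j - int l"] that(1)[of "j + int l"] that(1)[of "j - 2 * int l"] that(1)[of "j - int l - 1"]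
    by auto
  have "wp_coeff n a n \<noteq> 0"
    unfolding wp_coeff_def using nz[OF a(1)] nz[OF a(2)] nz[of "a + real n + 1"] nz[of "a - real n"] nzs[OF a]
    by (auto simp: pochhammer_eq_0_iff pochhammer_of_nat_eq_0_iff)
  moreover have "a + 2 * real n \<noteq> 0" using nzs(4)[OF a, of n 0] by simp
  moreover have "pochhammer (a + real n) n \<noteq> 0" by (rule nz) (rule nzs[OF a])
  ultimately show False by (simp add: pochhammer_of_nat_eq_0_iff)
qed

text \<open>
  This is Whipple's transformation of a terminating very-well-poised \<open>\<^sub>7F\<^sub>6\<close> to a balanced \<open>\<^sub>4F\<^sub>3\<close>: the
  terms of the latter are, up to a common factor, the \<open>Z k\<close> in the proof. Their ratio is nonnegative for \<open>k \<le> -a\<close>. For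
  \<open>k \<ge> -a\<close> it lies in \<open>(-1, 0]\<close>: the factor \<open>(k + a) / (k + 3/2 - a)\<close> is at most 1 since \<open>a \<le> 3/4\<close>,
  and the special value of \<open>y\<close> is large enough to bound the remaining factor.
\<close>
theorem wp_sum_nonzero:
  assumes a: "\<And>j::int. a \<noteq> of_int j" "\<And>j::int. a + 1/2 \<noteq> of_int j" and "a \<le> 3/4" and n: "n \<ge> 1"
    and y: "y = (real n)\<^sup>2 + real n - 1/16"
  shows "(\<Sum>i\<le>n. (a + 2 * real i) * wp_coeff n a i * (square_prod y (1/2) i / square_prod y (a + 1/2) i)) \<noteq> 0"
proof -
  have "(real n)\<^sup>2 \<ge> 0" "real n \<ge> 1" using n by auto
  then have ypos: "y > 0" unfolding y by linarith
  have an: "a + real j \<noteq> 0" for j using a(1)[of "- int j"] by auto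
  define B where "B = square_prod y (a + 1/2)"
  have Bpos: "B k > 0" for k unfolding B_def using ypos by (rule square_prod_pos)
  define Z where "Z = (\<lambda>k. pochhammer a k / (fact k * B k) * wp_moment n a k)"
  have "(\<Sum>i\<le>n. (a + 2 * real i) * wp_coeff n a i * (square_prod y (1/2) i / square_prod y (a + 1/2) i))
     = (\<Sum>i\<le>n. \<Sum>k\<le>n. (a + 2 * real i) * wp_coeff n a i * (pochhammer a k * pochhammer (a + real i) k * pochhammer (- real i) k /
            (fact k * B k)))"
    by (intro sum.cong refl) (simp add: saalschuetz[OF ypos an, symmetric] sum_distrib_left B_def)
  also have "\<dots> = (\<Sum>k\<le>n. \<Sum>i\<le>n. (a + 2 * real i) * wp_coeff n a i * (pochhammer a k * pochhammer (a + real i) k * pochhammer (- real i) k /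
            (fact k * B k)))"
    by (rule sum.swap)
  also have "\<dots> = (\<Sum>k\<le>n. Z k)"
    unfolding Z_def wp_moment_def sum_distrib_left by (intro sum.cong refl) simp
  finally have S: "(\<Sum>i\<le>n. (a + 2 * real i) * wp_coeff n a i * (square_prod y (1/2) i / square_prod y (a + 1/2) i)) = (\<Sum>k\<le>n. Z k)" .
  define b where "b = (\<lambda>k. (a + 1/2 + real k)\<^sup>2 + y)"
  have b: "b k \<ge> y" for k by (simp add: b_def)
  define r where "r = (\<lambda>k. (real k + a) / (real k + 3/2 - a) * ((real k + 1/2) * (real n + 1 + real k) * (real k - real n) / ((real k + 1) * b k)))"
  have Z: "Z (Suc k) = r k * Z k" for k
  proof -
    have nz: "real k + 3/2 - a \<noteq> 0" using \<open>a \<le> 3/4\<close> by linarith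
    have h: "wp_moment n a (Suc k) = (real k + 1/2) * (real n + 1 + real k) * (real k - real n) * wp_moment n a k / (real k + 3/2 - a)"
      using wp_moment_Suc[OF a, of k n] nz by (metis nonzero_mult_div_cancel_left)
    have BS: "B (Suc k) = B k * b k" by (simp add: B_def b_def square_prod_Suc)
    have gen: "P * t / (c * f * (B * b)) * (h * w / d) = t / d * (h / (c * b)) * (P / (f * B) * w)"
      for P t c f B b h w d :: real
      by (simp add: divide_inverse mult_ac)
    have FS: "fact (Suc k) = (real k + 1) * fact k" by simp
    show ?thesis unfolding Z_def r_def h BS FS pochhammer_Suc add.commute[of a "real k"] by (rule gen)
  qed
  \<comment> \<open>For \<open>k = 0\<close> the factor \<open>1/2\<close> matters: \<open>n\<^sup>2 + n\<close> alone exceeds \<open>y\<close>.\<close>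
  have nn: "(real k + 1/2) * (real n + 1 + real k) * (real n - real k) < (real k + 1) * b k" if "k < n" for k
  proof -
    have "(real k + 1/2) * ((real n + 1 + real k) * (real n - real k)) < (real k + 1) * y"
    proof (cases "k = 0")
      case True
      have "real n * real n \<ge> 1 * 1" using n by (intro mult_mono) auto
      then show ?thesis using n True by (simp add: y power2_eq_square field_simps) 
    next
      case False
      then have "real k * real k \<ge> 1" by (metis One_nat_def Suc_leI bot_nat_0.not_eq_extremum mult_le_mono nat_mult_1 of_nat_1 of_nat_le_iff of_nat_mult)
      then have "(real n + 1 + real k) * (real n - real k) \<le> y"
        by (simp add: y power2_eq_square algebra_simps)
      then have "(real k + 1/2) * ((real n + 1 + real k) * (real n - real k)) \<le> (real k + 1/2) * y"
        by (intro mult_left_mono) auto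
      also have "\<dots> < (real k + 1) * y" using ypos by (simp add: algebra_simps)
      finally show ?thesis .
    qed
    also have "\<dots> \<le> (real k + 1) * b k" using b[of k] by (intro mult_left_mono) auto
    finally show ?thesis by (simp add: mult.assoc)
  qed
  have bp: "b k > 0" for k using b[of k] ypos by linarith
  define q where "q = (\<lambda>k. (real k + 1/2) * (real n + 1 + real k) * (real n - real k) / ((real k + 1) * b k))"
  have q: "0 \<le> q k" "q k < 1" if "k < n" for k
    unfolding q_def using nn[OF that] bp[of k] that by auto
  have rq: "r k = - ((real k + a) / (real k + 3/2 - a)) * q k" for k
  proof -
    have "x * (h * (u - v) / c) = - x * (h * (v - u) / c)" for x h u v c :: real
      by (simp add: divide_inverse algebra_simps)
    then show ?thesis unfolding r_def q_def by (rule trans) simp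
  qed
  have r1: "r k \<ge> 0" if "k < n" "real k \<le> - a" for k
    unfolding rq using q(1)[OF that(1)] that(2) \<open>a \<le> 3/4\<close>
    by (intro mult_nonneg_nonneg) (auto simp: divide_le_0_iff)
  have r2: "- 1 < r k \<and> r k \<le> 0" if "k < n" "real k \<ge> - a" for k
  proof -
    define w where "w = (real k + a) / (real k + 3/2 - a)"
    have w: "0 \<le> w" "w \<le> 1" unfolding w_def using that(2) \<open>a \<le> 3/4\<close> by (auto simp: divide_le_eq_1)
    have "w * q k \<le> 1 * q k" using w q(1)[OF that(1)] by (intro mult_right_mono) auto
    moreover have "w * q k \<ge> 0" using w q(1)[OF that(1)] by simp
    ultimately show ?thesis using q(2)[OF that(1)] unfolding rq w_def[symmetric] by simp
  qed
  have Z0: "Z 0 \<noteq> 0" using wp_moment_0_nonzero[OF a \<open>a \<le> 3/4\<close>, of n] by (simp add: Z_def B_def)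
  have "(\<Sum>k\<le>n. Z k / Z 0) > 0"
    by (rule alternating_sum_pos[where r = r and s = "- a"]) (use Z Z0 r1 r2 in \<open>auto simp: field_simps\<close>)
  then have "(\<Sum>k\<le>n. Z k) \<noteq> 0"
    by (auto simp flip: sum_divide_distrib)
  then show ?thesis using S by simp
qed

section \<open>The leading coefficients and their first perturbation\<close>

text \<open>The values of the coefficient of \<open>x\<^sup>-\<^sup>4\<close> for which the chain of leading coefficients breaks off.\<close>
definition critical_value :: "nat \<Rightarrow> real" where
  "critical_value i = real i * (4 * real i + 1) * (4 * real i + 3) * (4 * real i + 4)"

text \<open>The coefficient of \<open>x\<^sup>-\<^sup>4\<^sup>i\<close> in \<open>a\<^sub>i\<close> when \<open>u\<close> starts with \<open>critical_value n\<close> times \<open>x\<^sup>-\<^sup>4\<close>.\<close>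
fun leading :: "nat \<Rightarrow> nat \<Rightarrow> real" where
  "leading n 0 = 1"
| "leading n (Suc i) = leading n i * ((2 * real i + 1) * (critical_value n - critical_value i) / (2 * (real i + 1)))"

text \<open>
  For \<open>u = \<phi> x\<^sup>-\<^sup>4\<close> the operator \<open>f \<mapsto> f\<^sup>(\<^sup>5\<^sup>) - 4 u f' - 2 u' f\<close> multiplies \<open>x\<^sup>p\<close> by \<open>x\<^sup>p\<^sup>-\<^sup>5\<close> times a
  polynomial in \<open>p\<close>. The following is \<open>-1/4\<close> of this polynomial for \<open>\<phi> = critical_value n\<close>. For this
  \<open>\<phi>\<close> its rational roots are \<open>2\<close>, \<open>-4n\<close> and \<open>4n + 4\<close> if \<open>n \<ge> 1\<close> (lemma \<open>indicial_factor\<close>).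
\<close>
definition indicial :: "nat \<Rightarrow> int \<Rightarrow> real" where
  "indicial n p = (real_of_int p - 2) * (critical_value n - real_of_int (p * (p - 1) * (p - 3) * (p - 4)) / 4)"

text \<open>
  If \<open>u\<close> contains a further term \<open>\<epsilon> x\<^sup>m\<close>, then \<open>a\<^sub>i\<close> contains \<open>\<epsilon>\<close> times this number times
  \<open>x\<^sup>m\<^sup>+\<^sup>4\<^sup>-\<^sup>4\<^sup>i\<close>, to first order in \<open>\<epsilon>\<close>.
\<close>
fun perturbation :: "nat \<Rightarrow> int \<Rightarrow> nat \<Rightarrow> real" where
  "perturbation n m 0 = 0"
| "perturbation n m (Suc i) = (indicial n (m + 4 - 4 * int i) * perturbation n m i + (real_of_int m / 2 - 4 * real i) * leading n i)
     / (real_of_int m - 4 * real i)"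

lemma critical_value_diff: "critical_value n - critical_value i = 4 * (real n - real i) * (real n + real i + 1) * (16 * (real n * real n + real n + real i * real i + real i) + 3)"
  unfolding critical_value_def by (simp add: algebra_simps)

lemma leading_pos: "i \<le> n \<Longrightarrow> leading n i > 0"
proof (induction i)
  case (Suc i)
  then show ?case unfolding leading.simps critical_value_diff
    by (intro mult_pos_pos divide_pos_pos) (auto intro: add_nonneg_pos)
qed auto

lemma leading_eq_0: "i > n \<Longrightarrow> leading n i = 0"
proof (induction i)
  case (Suc i)
  then show ?case by (cases "i = n") auto
qed auto

lemma indicial_factor:
  "indicial n p = (real_of_int p - 2) * (4 * real n + real_of_int p) * (4 * real n + 4 - real_of_int p) *
     ((real_of_int p - 1) * (real_of_int p - 3) + 16 * real n * (real n + 1)) / 4"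
  unfolding indicial_def critical_value_def by (simp add: field_simps)

lemma indicial_nonzero:
  assumes "\<not> 4 dvd p" "p \<noteq> 2" "n \<ge> 1 \<or> p < 0"
  shows "indicial n p \<noteq> 0"
proof -
  have "(p - 1) * (p - 3) + 16 * int n * (int n + 1) > 0"
  proof (cases "n \<ge> 1")
    case True
    have "(p - 1) * (p - 3) = (p - 2)\<^sup>2 - 1" by (simp add: power2_eq_square algebra_simps)
    then have "(p - 1) * (p - 3) \<ge> -1" using zero_le_power2[of "p - 2"] by linarith
    moreover have "int n * (int n + 1) \<ge> 1 * 1" using True by (intro mult_mono) auto
    ultimately show ?thesis by simp
  next
    case False
    then have "p < 0" using assms by simp
    then have "(p - 1) * (p - 3) > 0" by (simp add: mult_neg_neg)
    moreover have "n = 0" using False by simp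
    ultimately show ?thesis by simp
  qed
  then have "real_of_int ((p - 1) * (p - 3) + 16 * int n * (int n + 1)) \<noteq> 0"
    by (metis of_int_eq_0_iff less_irrefl)
  then have 1: "(real_of_int p - 1) * (real_of_int p - 3) + 16 * real n * (real n + 1) \<noteq> 0"
    by simp
  have "4 * int n + p \<noteq> 0" "4 * int n + 4 - p \<noteq> 0" using assms(1) by presburger+
  then have "real_of_int (4 * int n + p) \<noteq> 0" "real_of_int (4 * int n + 4 - p) \<noteq> 0"
    by (metis of_int_eq_0_iff)+
  then have 2: "4 * real n + real_of_int p \<noteq> 0" "4 * real n + 4 - real_of_int p \<noteq> 0"
    by simp_all
  have 3: "real_of_int p - 2 \<noteq> 0" using assms(2) by simp
  show ?thesis unfolding indicial_factor using 1 2 3 by simp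
qed

text \<open>
  Beyond the index \<open>n\<close> the inhomogeneity has disappeared, and the indicial polynomial is evaluated
  at nonroots only.
\<close>
lemma perturbation_tail:
  assumes "perturbation n m (Suc n) \<noteq> 0" "\<not> 4 dvd m"
    and "\<And>i. i > n \<Longrightarrow> m + 4 - 4 * int i \<noteq> 2" "n \<ge> 1 \<or> m < 0" "j \<ge> n"
  shows "perturbation n m (Suc j) \<noteq> 0"
  using \<open>j \<ge> n\<close>
proof (induction j rule: dec_induct)
  case (step i)
  have "\<not> 4 dvd m + 4 - 4 * int (Suc i)" using \<open>\<not> 4 dvd m\<close> by presburger
  then have "indicial n (m + 4 - 4 * int (Suc i)) \<noteq> 0"
    using assms(3)[of "Suc i"] assms(4) step.hyps by (intro indicial_nonzero) auto
  moreover have "real_of_int (m - 4 * int (Suc i)) \<noteq> 0"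
    using \<open>\<not> 4 dvd m\<close> unfolding of_int_eq_0_iff by presburger
  moreover have "leading n (Suc i) = 0" using step.hyps by (intro leading_eq_0) simp
  ultimately show ?case using step.IH unfolding perturbation.simps(2)[of n m "Suc i"] by (simp del: leading.simps perturbation.simps)
qed fact

text \<open>
  Divide the recursion by \<open>m - 4i\<close>. For \<open>i \<le> n\<close> and an exponent \<open>m + 4 - 4i \<le> 2\<close>, the homogeneous
  factor is then nonnegative and the inhomogeneity is positive. If \<open>m < 0\<close>, this covers all \<open>i > 0\<close>,
  and at \<open>i = 0\<close> there is only the inhomogeneity. If \<open>m = 4k - 2\<close>, the exponent is 2 at \<open>i = k\<close>, where
  the factor vanishes and whatever came before is forgotten.
\<close>
lemma perturbation_nonzero_simple:
  assumes "-3 \<le> m" and m: "m < 0 \<or> (\<exists>k. 1 \<le> k \<and> k \<le> n \<and> m = 4 * int k - 2)" and "j \<ge> n"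
  shows "perturbation n m (Suc j) \<noteq> 0"
proof -
  \<comment> \<open>The step at \<open>i0\<close> has no homogeneous part.\<close>
  define i0 where "i0 = (if m < 0 then 0 else nat ((m + 2) div 4))"
  have m4: "\<not> 4 dvd m" using m \<open>-3 \<le> m\<close> by presburger
  have i0: "i0 \<le> n" using m by (auto simp: i0_def)
  have mi: "m < 4 * int i \<and> (i = 0 \<or> m + 4 - 4 * int i \<le> 2)" if "i \<ge> i0" for i
    using that m by (auto simp: i0_def split: if_splits)
  have start: "indicial n (m + 4 - 4 * int i0) * perturbation n m i0 = 0"
    using m by (auto simp: i0_def indicial_def)
  have src: "(real_of_int m / 2 - 4 * real i) * leading n i / (real_of_int m - 4 * real i) > 0" if "i0 \<le> i" "i \<le> n" for i
  proof -
    have "m - 8 * int i < 0" "m - 4 * int i < 0" using mi[OF that(1)] by auto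
    then have "real_of_int (m - 8 * int i) < 0" "real_of_int (m - 4 * int i) < 0"
      unfolding of_int_less_0_iff by blast+
    then have "real_of_int m / 2 - 4 * real i < 0" "real_of_int m - 4 * real i < 0" by simp_all
    then show ?thesis using leading_pos[OF that(2)] by (simp add: zero_less_divide_iff mult_less_0_iff)
  qed
  have "i \<le> n \<longrightarrow> perturbation n m (Suc i) > 0" if "i \<ge> i0" for i
    using that
  proof (induction i rule: dec_induct)
    case base
    show ?case using src[of i0] by (auto simp only: perturbation.simps start add_0_left order_refl)
  next
    case (step i)
    show ?case
    proof
      assume i: "Suc i \<le> n"
      define p where "p = m + 4 - 4 * int (Suc i)"
      have p2: "p \<le> 2" using mi[of "Suc i"] step.hyps by (simp add: p_def)
      have pn: "- 4 * int n \<le> p" using i \<open>-3 \<le> m\<close> by (simp add: p_def)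
      have "indicial n p \<le> 0"
      proof (cases "p = 2")
        case True
        then show ?thesis by (simp add: indicial_def)
      next
        case False
        then have "p \<le> 1" using p2 by simp
        then have q: "real_of_int p \<le> 1" by simp
        have "real_of_int (- 4 * int n) \<le> real_of_int p" using pn by (rule of_int_le_iff[THEN iffD2])
        then have "4 * real n + real_of_int p \<ge> 0" "4 * real n + 4 - real_of_int p \<ge> 0" "2 - real_of_int p \<ge> 0"
          using q by simp_all
        moreover have "(1 - real_of_int p) * (3 - real_of_int p) + 16 * real n * (real n + 1) \<ge> 0"
          using q by (intro add_nonneg_nonneg mult_nonneg_nonneg) auto
        ultimately have "(2 - real_of_int p) * (4 * real n + real_of_int p) * (4 * real n + 4 - real_of_int p) *
     ((1 - real_of_int p) * (3 - real_of_int p) + 16 * real n * (real n + 1)) \<ge> 0"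
          by simp
        then show ?thesis unfolding indicial_factor by (simp add: algebra_simps)
      qed
      moreover have "real_of_int m - 4 * real (Suc i) < 0"
      proof -
        have "m - 4 * int (Suc i) < 0" using mi[of "Suc i"] step.hyps by auto
        then have "real_of_int (m - 4 * int (Suc i)) < 0" unfolding of_int_less_0_iff .
        then show ?thesis by simp
      qed
      moreover have "perturbation n m (Suc i) > 0" using step i by simp
      ultimately have "indicial n p * perturbation n m (Suc i) / (real_of_int m - 4 * real (Suc i)) \<ge> 0"
        by (metis divide_nonpos_neg mult_nonpos_nonneg less_imp_le)
      moreover have "perturbation n m (Suc (Suc i)) = indicial n p * perturbation n m (Suc i) / (real_of_int m - 4 * real (Suc i))
          + (real_of_int m / 2 - 4 * real (Suc i)) * leading n (Suc i) / (real_of_int m - 4 * real (Suc i))"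
        by (simp only: perturbation.simps p_def add_divide_distrib)
      ultimately show "perturbation n m (Suc (Suc i)) > 0" using src[of "Suc i"] step.hyps i by simp
    qed
  qed
  then have "perturbation n m (Suc n) \<noteq> 0" using i0 by (metis less_irrefl order_refl)
  then show ?thesis
  proof (rule perturbation_tail)
    show "m + 4 - 4 * int i \<noteq> 2" if "i > n" for i using m that by auto
  qed (use m m4 \<open>j \<ge> n\<close> in auto)
qed

text \<open>
  Variation of constants with the homogeneous solution \<open>F\<close>. In terms of \<open>a = -m/4\<close> the factor
  \<open>f i\<close> of the perturbation is the factor of the leading coefficients with \<open>i\<close> shifted by \<open>a\<close>,
  which makes the resulting sum very-well-poised.
\<close>
lemma perturbation_nonzero_odd:
  assumes "odd m" "-3 \<le> m" "n \<ge> 1" "j \<ge> n"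
  shows "perturbation n m (Suc j) \<noteq> 0"
proof -
  define a where "a = - real_of_int m / 4"
  define y where "y = (real n)\<^sup>2 + real n - 1/16"
  have n1: "real n \<ge> 1" "(real n)\<^sup>2 \<ge> 0" using \<open>n \<ge> 1\<close> by auto
  have ypos: "y > 0" unfolding y_def using n1 by linarith
  have a1: "a \<noteq> of_int k" for k :: int
  proof
    assume "a = of_int k"
    then have "real_of_int m = real_of_int (- 4 * k)" by (simp add: a_def)
    then have "m = - 4 * k" by (rule of_int_eq_iff[THEN iffD1])
    then show False using \<open>odd m\<close> by simp
  qed
  have a2: "a + 1/2 \<noteq> of_int k" for k :: int
  proof
    assume "a + 1/2 = of_int k"
    then have "real_of_int m = real_of_int (2 - 4 * k)" by (simp add: a_def)
    then have "m = 2 - 4 * k" by (rule of_int_eq_iff[THEN iffD1])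
    then show False using \<open>odd m\<close> by simp
  qed
  have a3: "a \<le> 3/4" using \<open>-3 \<le> m\<close> by (simp add: a_def)
  define V where "V = (\<lambda>i. square_prod y (1/2) i / square_prod y (a + 1/2) i)"
  define f where "f = (\<lambda>i. indicial n (m - 4 * int i) / (real_of_int m - 4 * real (Suc i)))"
  define F where "F = (\<lambda>i. \<Prod>j<i. f j)"
  have FS: "F (Suc i) = F i * f i" for i by (simp add: F_def)
  have ai: "a + real i \<noteq> 0" "a + real i + 1 \<noteq> 0" "a + 1/2 + real i \<noteq> 0" "a + real n + 1 + real i \<noteq> 0" "a - real n + real i \<noteq> 0" for i
    using a1[of "- int i"] a1[of "- int i - 1"] a2[of "- int i"] a1[of "- int i - 1 - int n"] a1[of "- int i + int n"] by auto
  have f: "f i = 64 * (a + 1/2 + real i) * - (a - real n + real i) * (a + real n + 1 + real i) * ((a + 1/2 + real i)\<^sup>2 + y) / (a + real i + 1)" for i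
  proof -
    define t where "t = a + real i"
    have p: "real_of_int (m - 4 * int i) = - 4 * t" "real_of_int m - 4 * real (Suc i) = - 4 * (t + 1)" 
      by (simp_all add: a_def t_def)
    have "f i = 64 * (t + 1/2) * (real n - t) * (real n + 1 + t) * ((t + 1/2)\<^sup>2 + y) / (t + 1)"
      unfolding f_def indicial_factor p y_def using ai(2)[of i] by (simp add: t_def[symmetric] divide_simps) (simp add: algebra_simps power2_eq_square)
    then show ?thesis by (simp add: t_def add_ac algebra_simps)
  qed
  have fnz: "f i \<noteq> 0" for i
    unfolding f using ai[of i] ypos by (auto simp: add_nonneg_pos intro!: gr_implies_not0 less_imp_neq[symmetric])
  have Fnz: "F i \<noteq> 0" for i unfolding F_def using fnz by simp
  have anz: "a \<noteq> 0" using a1[of 0] by simp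
  \<comment> \<open>The quotient \<open>leading n i / F i\<close> is hypergeometric in \<open>i\<close>.\<close>
  have leading: "leading n i = F i * (wp_coeff n a i * (a + real i) / a * V i)" for i
  proof (induction i)
    case 0
    then show ?case using anz by (simp add: F_def V_def)
  next
    case (Suc i)
    define Y1 Y2 where "Y1 = (1/2 + real i)\<^sup>2 + y" and "Y2 = (a + 1/2 + real i)\<^sup>2 + y"
    have Y: "Y1 > 0" "Y2 > 0" unfolding Y1_def Y2_def using ypos by (auto intro: add_nonneg_pos)
    have VS: "V (Suc i) = V i * Y1 / Y2" by (simp add: V_def square_prod_Suc Y1_def Y2_def)
    have l: "(2 * real i + 1) * (critical_value n - critical_value i) / (2 * (real i + 1)) = 64 * (1/2 + real i) * (real n - real i) * (real n + 1 + real i) * Y1 / (1 + real i)"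
      unfolding critical_value_diff Y1_def y_def by (simp add: divide_simps) (simp add: algebra_simps power2_eq_square)
    have gen: "F * (w * t / A * V) * (64 * h * N * q * Y1 / d) =
       F * (64 * x1 * - x3 * x2 * Y2 / t1) * (w * (t * h * - N * q / (d * x1 * x2 * x3)) * t1 / A * (V * Y1 / Y2))"
      if "x1 \<noteq> 0" "x2 \<noteq> 0" "x3 \<noteq> 0" "t1 \<noteq> 0" "Y2 \<noteq> 0" for F w t A V h N q Y1 d x1 x2 x3 Y2 t1 :: real
      using that by (simp add: divide_simps)
    have m: "real i - real n = - (real n - real i)" "a + real (Suc i) = a + real i + 1" by simp_all
    show ?case unfolding leading.simps Suc.IH FS l f wp_coeff_Suc VS Y2_def[symmetric] m
      by (rule gen) (use ai[of i] Y in auto)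
  qed
  have perturbation: "perturbation n m (Suc i) = F i / (2 * a) * (\<Sum>l\<le>i. (a + 2 * real l) * wp_coeff n a l * V l)" for i
  proof (induction i)
    case 0
    have "m \<noteq> 0" using \<open>odd m\<close> by auto
    then show ?case using anz by (simp add: F_def V_def)
  next
    case (Suc i)
    have r: "real_of_int m - 4 * real (Suc i) = - 4 * (a + real i + 1)" "real_of_int m / 2 - 4 * real (Suc i) = - 2 * (a + 2 * real (Suc i))"
      by (simp_all add: a_def)
    have p: "m + 4 - 4 * int (Suc i) = m - 4 * int i" by simp
    have l: "leading n (Suc i) = F (Suc i) * (wp_coeff n a (Suc i) * (a + real i + 1) / a * V (Suc i))"
      using leading[of "Suc i"] by (simp add: add_ac)
    have "perturbation n m (Suc (Suc i)) = f i * perturbation n m (Suc i) + (- 2 * (a + 2 * real (Suc i))) * leading n (Suc i) / (- 4 * (a + real i + 1))"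
      unfolding perturbation.simps(2)[of n m "Suc i"] p f_def add_divide_distrib r by simp
    also have "(- 2 * (a + 2 * real (Suc i))) * leading n (Suc i) / (- 4 * (a + real i + 1)) = 
        F (Suc i) / (2 * a) * ((a + 2 * real (Suc i)) * wp_coeff n a (Suc i) * V (Suc i))"
    proof -
      have "(- 2 * A) * (F * (w * t / a * v)) / (- 4 * t) = F / (2 * a) * (A * w * v)" if "t \<noteq> 0" for A F w t v :: real
        using that anz by (simp add: field_simps)
      then show ?thesis unfolding l using ai(2)[of i] by blast
    qed
    finally show ?case unfolding Suc.IH FS by (simp add: algebra_simps)
  qed
  have "perturbation n m (Suc n) \<noteq> 0"
    unfolding perturbation V_def using wp_sum_nonzero[OF a1 a2 a3 \<open>n \<ge> 1\<close> y_def] Fnz anz by simp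
  then show ?thesis
    by (rule perturbation_tail) (use assms in \<open>auto, presburger+\<close>)
qed

section \<open>Poles of a potential with a terminating recursion\<close>

unbundle fps_syntax

text \<open>The Cauchy product with lower bounds for the orders in place of the exact orders.\<close>
lemma fls_times_nth_bounded:
  fixes f g :: "complex fls"
  assumes f: "\<And>k. k < s \<Longrightarrow> f $$ k = 0" and g: "\<And>k. k < t \<Longrightarrow> g $$ k = 0"
  shows "(f * g) $$ e = (\<Sum>j=s..e - t. f $$ j * g $$ (e - j))"
proof (cases "f = 0 \<or> g = 0")
  case False
  have 1: "s \<le> fls_subdegree f" "t \<le> fls_subdegree g"
    using False f g by (auto intro: fls_subdegree_geI)
  show ?thesis
    unfolding fls_times_nth(2)
    by (rule sum.mono_neutral_left) (use 1 in \<open>auto simp: not_le intro!: mult_eq_0_iff[THEN iffD2]\<close>)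
qed auto

text \<open>
  The equation \<open>Q\<^sup>(\<^sup>5\<^sup>) + 4 (z - U) Q' - 2 U' Q = 0\<close> for \<open>Q = z\<^sup>g + a\<^sub>1 z\<^sup>g\<^sup>-\<^sup>1 + \<dots>\<close>, compared by powers of \<open>z\<close>.
\<close>
definition lax_recursion :: "complex fls \<Rightarrow> (nat \<Rightarrow> complex fls) \<Rightarrow> bool" where
  "lax_recursion U a \<longleftrightarrow> a 0 = 1 \<and>
     (\<forall>i. 4 * fls_deriv (a (Suc i)) =
          4 * U * fls_deriv (a i) + 2 * fls_deriv U * a i - (fls_deriv ^^ 5) (a i))"

lemma lax_recursion_nth:
  assumes rec: "lax_recursion U a"
    and U: "\<And>k. k < s \<Longrightarrow> U $$ k = 0" and A: "\<And>k. k < t \<Longrightarrow> a i $$ k = 0"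
  shows "4 * of_int e * a (Suc i) $$ e =
     (\<Sum>j=s..e - t. of_int (4 * (e - j) + 2 * j) * (U $$ j * a i $$ (e - j)))
     - of_int (e * (e + 1) * (e + 2) * (e + 3) * (e + 4)) * a i $$ (e + 4)"
proof -
  have 1: "(U * fls_deriv (a i)) $$ (e - 1) = (\<Sum>j=s..e - 1 - (t - 1). U $$ j * fls_deriv (a i) $$ (e - 1 - j))"
    by (rule fls_times_nth_bounded) (use U A in auto)
  also have "\<dots> = (\<Sum>j=s..e - t. U $$ j * (of_int (e - j) * a i $$ (e - j)))"
    by (intro sum.cong) (auto simp: algebra_simps)
  finally have 1: "(U * fls_deriv (a i)) $$ (e - 1) = (\<Sum>j=s..e - t. U $$ j * (of_int (e - j) * a i $$ (e - j)))" .
  have 2: "(fls_deriv U * a i) $$ (e - 1) = (\<Sum>j=s-1..e - 1 - t. fls_deriv U $$ j * a i $$ (e - 1 - j))"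
    by (rule fls_times_nth_bounded) (use U A in auto)
  also have "\<dots> = (\<Sum>j=s..e - t. of_int j * U $$ j * a i $$ (e - j))"
    by (rule sum.reindex_bij_witness[where i = "\<lambda>j. j - 1" and j = "\<lambda>j. j + 1"])
      (auto simp: algebra_simps)
  finally have 2: "(fls_deriv U * a i) $$ (e - 1) = (\<Sum>j=s..e - t. of_int j * U $$ j * a i $$ (e - j))" .
  have "4 * of_int e * a (Suc i) $$ e = (4 * fls_deriv (a (Suc i))) $$ (e - 1)"
    by simp
  also have "\<dots> = (4 * (U * fls_deriv (a i)) + 2 * (fls_deriv U * a i) - (fls_deriv ^^ 5) (a i)) $$ (e - 1)"
    using rec unfolding lax_recursion_def by (simp add: mult.assoc)
  also have "\<dots> = 4 * (\<Sum>j=s..e - t. U $$ j * (of_int (e - j) * a i $$ (e - j)))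
       + 2 * (\<Sum>j=s..e - t. of_int j * U $$ j * a i $$ (e - j))
       - of_int (e * (e + 1) * (e + 2) * (e + 3) * (e + 4)) * a i $$ (e + 4)"
    unfolding fls_minus_nth fls_plus_nth fls_mult_of_numeral_nth 1 2
    by (simp add: eval_nat_numeral) (simp add: algebra_simps)
  also have "4 * (\<Sum>j=s..e - t. U $$ j * (of_int (e - j) * a i $$ (e - j)))
       + 2 * (\<Sum>j=s..e - t. of_int j * U $$ j * a i $$ (e - j)) =
      (\<Sum>j=s..e - t. of_int (4 * (e - j) + 2 * j) * (U $$ j * a i $$ (e - j)))"
    unfolding sum_distrib_left sum.distrib[symmetric] by (intro sum.cong refl) (simp add: algebra_simps)
  finally show ?thesis .
qed

text \<open>
  If the pole has order \<open>w > 4\<close>, then in the recursion the term \<open>a\<^sub>i\<^sup>(\<^sup>5\<^sup>)\<close> is of lower order than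
  \<open>u a\<^sub>i'\<close>. So \<open>a\<^sub>i\<close> has a pole of order exactly \<open>w i\<close> for all \<open>i\<close>.
\<close>
lemma lax_pole_order_le_4:
  assumes rec: "lax_recursion U a" and fin: "a (Suc g) = 0" and k: "k < -4"
  shows "U $$ k = 0"
proof (rule ccontr)
  assume nz: "U $$ k \<noteq> 0"
  then have "U \<noteq> 0" by auto
  define w where "w = - fls_subdegree U"
  have w: "w > 4" using fls_subdegree_leI[OF nz] k by (simp add: w_def)
  have Uw: "U $$ (- w) \<noteq> 0" using \<open>U \<noteq> 0\<close> by (simp add: w_def)
  have Ul: "U $$ j = 0" if "j < - w" for j using that by (simp add: w_def)
  have "(\<forall>e < - w * int i. a i $$ e = 0) \<and> a i $$ (- w * int i) \<noteq> 0" for i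
  proof (induction i)
    case 0
    then show ?case using rec by (simp add: lax_recursion_def)
  next
    case (Suc i)
    note nth = lax_recursion_nth[OF rec, of "-w" "- w * int i" i]
    have A: "a (Suc i) $$ e = 0" if e: "e < - w * int (Suc i)" for e
    proof -
      have "e < - w * int i - w" using e by (simp add: algebra_simps)
      moreover have "- w * int i \<le> 0" using w by simp
      ultimately have "e - (- w * int i) < -w" "e + 4 < - w * int i" "e \<noteq> 0" using w by linarith+
      then show ?thesis using nth[of e] Ul Suc by simp
    qed
    define e where "e = - w * int (Suc i)"
    have e: "e - (- w * int i) = - w" "e + 4 < - w * int i" "e + w = - w * int i" 
      using w by (simp_all add: e_def algebra_simps)
    have "4 * of_int e * a (Suc i) $$ e = of_int (4 * (e + w) - 2 * w) * (U $$ (- w) * a i $$ (- w * int i))"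
      using nth[of e, unfolded e(1)] Ul Suc e(2) unfolding e(3)[symmetric] by simp
    moreover have "4 * (e + w) - 2 * w < 0"
    proof -
      have "e + w \<le> 0" using w unfolding e(3) by simp
      then show ?thesis using w by presburger
    qed
    ultimately have "a (Suc i) $$ e \<noteq> 0" using Uw Suc by (auto simp del: of_int_add of_int_mult of_int_diff)
    then show ?case using A unfolding e_def by blast
  qed
  from this[of "Suc g"] show False using fin by simp
qed

text \<open>The number \<open>n\<close> is the index at which the chain of leading coefficients breaks off.\<close>
lemma lax_leading_coefficient:
  assumes rec: "lax_recursion U a" and fin: "a (Suc g) = 0"
  obtains n where "U $$ (-4) = of_real (critical_value n)"
    and "\<And>i e. e < - 4 * int i \<Longrightarrow> a i $$ e = 0"
    and "\<And>i. a i $$ (- 4 * int i) = of_real (leading n i)"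
proof -
  have Ul: "U $$ j = 0" if "j < - 4" for j using lax_pole_order_le_4[OF rec fin that] .
  have low: "a i $$ e = 0" if "e < - 4 * int i" for i e
    using that
  proof (induction i arbitrary: e)
    case (Suc i)
    have "4 * of_int e * a (Suc i) $$ e = 0"
      using lax_recursion_nth[OF rec, of "-4" "- 4 * int i" i e] Ul Suc by simp
    then show ?case using Suc.prems by simp
  qed (use rec in \<open>simp add: lax_recursion_def\<close>)
  define \<phi> where "\<phi> = U $$ (-4)"
  define \<alpha> where "\<alpha> = (\<lambda>i. a i $$ (- 4 * int i))"
  have step: "2 * of_nat (Suc i) * \<alpha> (Suc i) = (2 * of_nat i + 1) * (\<phi> - of_real (critical_value i)) * \<alpha> i" for i
  proof -
    define e where "e = - 4 * int (Suc i)"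
    have e: "e - (- 4 * int i) = - 4" "e + 4 = - 4 * int i" by (simp_all add: e_def)
    have 1: "4 * of_int e * \<alpha> (Suc i) = of_int (4 * (e + 4) - 8) * (\<phi> * \<alpha> i)
        - of_int (e * (e + 1) * (e + 2) * (e + 3) * (e + 4)) * \<alpha> i"
      using lax_recursion_nth[OF rec, of "-4" "- 4 * int i" i e] Ul low e
      by (simp add: \<alpha>_def \<phi>_def e_def)
    have "(- 8) * (2 * of_nat (Suc i) * \<alpha> (Suc i)) = (- 8) * ((2 * of_nat i + 1) * (\<phi> - of_real (critical_value i)) * \<alpha> i)"
      using 1 unfolding e_def critical_value_def by (simp add: algebra_simps)
    then show ?thesis by simp
  qed
  have "\<alpha> (Suc g) = 0" "\<alpha> 0 = 1" using fin rec by (simp_all add: \<alpha>_def lax_recursion_def)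
  have "\<exists>n. \<alpha> n \<noteq> 0 \<and> \<alpha> (Suc n) = 0"
  proof (rule ccontr)
    assume *: "\<not> ?thesis"
    have "\<alpha> i \<noteq> 0" for i by (induction i) (use * \<open>\<alpha> 0 = 1\<close> in auto)
    then show False using \<open>\<alpha> (Suc g) = 0\<close> by blast
  qed
  then obtain n where n: "\<alpha> n \<noteq> 0" "\<alpha> (Suc n) = 0" by blast
  have "(2 * of_nat n + 1 :: complex) \<noteq> 0"
    by (metis of_nat_Suc of_nat_eq_0_iff of_nat_mult of_nat_numeral nat.distinct(1) add.commute)
  then have \<phi>: "\<phi> = of_real (critical_value n)" using step[of n] n by simp
  have "\<alpha> i = of_real (leading n i)" for i
  proof (induction i)
    case 0
    then show ?case using \<open>\<alpha> 0 = 1\<close> by simp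
  next
    case (Suc i)
    have "2 * real (Suc i) * leading n (Suc i) = (2 * real i + 1) * (critical_value n - critical_value i) * leading n i"
      by (simp add: field_simps)
    then have "complex_of_real (2 * real (Suc i) * leading n (Suc i)) = complex_of_real ((2 * real i + 1) * (critical_value n - critical_value i) * leading n i)"
      by (rule arg_cong)
    then have "2 * of_nat (Suc i) * \<alpha> (Suc i) = 2 * of_nat (Suc i) * of_real (leading n (Suc i))"
      unfolding step \<phi> Suc.IH by (simp del: leading.simps)
    moreover have "(2 * of_nat (Suc i) :: complex) \<noteq> 0" by (simp del: of_nat_Suc)
    ultimately show ?case by (metis mult_left_cancel)
  qed
  then show ?thesis using that[of n] \<phi> low unfolding \<phi>_def \<alpha>_def by blast
qed

text \<open>
  Below the exponent \<open>m\<close> all exponents in \<open>u\<close> are divisible by \<open>d\<close>, hence also those in \<open>a\<^sub>i\<close> below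
  \<open>m + 4 - 4i\<close>. In the recursion for the coefficient at \<open>m + 4 - 4i\<close> only the products with the
  coefficients of \<open>x\<^sup>-\<^sup>4\<close> and of \<open>x\<^sup>m\<close> in \<open>u\<close> are left.
\<close>
lemma lax_first_perturbation:
  fixes m d :: int
  assumes rec: "lax_recursion U a" and fin: "a (Suc g) = 0"
    and \<phi>: "U $$ (-4) = of_real (critical_value n)"
    and low: "\<And>i e. e < - 4 * int i \<Longrightarrow> a i $$ e = 0"
    and leading: "\<And>i. a i $$ (- 4 * int i) = of_real (leading n i)"
    and d: "d dvd 4" "\<not> d dvd m" and m: "-4 < m"
    and first: "\<And>j. j < m \<Longrightarrow> \<not> d dvd j \<Longrightarrow> U $$ j = 0"
  shows "(\<forall>e. e < m + 4 - 4 * int i \<longrightarrow> \<not> d dvd e \<longrightarrow> a i $$ e = 0) \<and>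
    a i $$ (m + 4 - 4 * int i) = U $$ m * of_real (perturbation n m i)"
proof (induction i)
  case 0
  have "\<not> d dvd m + 4" using d by (metis dvd_add_left_iff)
  then have "m + 4 \<noteq> 0" by auto
  then show ?case using rec by (auto simp: lax_recursion_def fls_one_nth) 
next
  case (Suc i)
  have Ul: "U $$ j = 0" if "j < - 4" for j using lax_pole_order_le_4[OF rec fin that] .
  note nth = lax_recursion_nth[OF rec, of "-4" "- 4 * int i" i, OF Ul low]
  have d4: "d dvd 4 * x" for x using d(1) by simp
  have A: "a (Suc i) $$ e = 0" if e: "e < m - 4 * int i" "\<not> d dvd e" for e
  proof -
    have "\<not> d dvd e + 4" using e(2) d(1) by (metis dvd_add_left_iff)
    then have "a i $$ (e + 4) = 0" using Suc e by simp
    moreover have "(\<Sum>j=-4..e - (- 4 * int i). of_int (4 * (e - j) + 2 * j) * (U $$ j * a i $$ (e - j))) = 0"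
    proof (intro sum.neutral ballI)
      fix j assume j: "j \<in> {-4..e - (- 4 * int i)}"
      then have "j < m" using e by simp
      show "of_int (4 * (e - j) + 2 * j) * (U $$ j * a i $$ (e - j)) = 0"
      proof (cases "d dvd j")
        case True
        then have "\<not> d dvd e - j" using e(2) by (metis dvd_diff_left_iff dvd_add_left_iff diff_add_cancel)
        then show ?thesis using Suc e j by simp
      qed (use first \<open>j < m\<close> in simp)
    qed
    ultimately have "4 * of_int e * a (Suc i) $$ e = 0" using nth[of e] by simp
    moreover have "e \<noteq> 0" using e(2) by auto
    ultimately show ?thesis by simp
  qed
  define e where "e = m - 4 * int i"
  have de: "\<not> d dvd e" unfolding e_def using d(2) d4[of "int i"] by (metis dvd_diff_left_iff dvd_add_left_iff diff_add_cancel)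
  then have enz: "e \<noteq> 0" by auto
  define p where "p = m + 4 - 4 * int i"
  have S: "(\<Sum>j=-4..e - (- 4 * int i). of_int (4 * (e - j) + 2 * j) * (U $$ j * a i $$ (e - j)))
     = (\<Sum>j\<in>{-4, m}. of_int (4 * (e - j) + 2 * j) * (U $$ j * a i $$ (e - j)))"
  proof (rule sum.mono_neutral_right)
    show "\<forall>j\<in>{-4..e - (- 4 * int i)} - {-4, m}. of_int (4 * (e - j) + 2 * j) * (U $$ j * a i $$ (e - j)) = 0"
    proof
      fix j assume j: "j \<in> {-4..e - (- 4 * int i)} - {-4, m}"
      then have "j < m" by (simp add: e_def)
      show "of_int (4 * (e - j) + 2 * j) * (U $$ j * a i $$ (e - j)) = 0"
      proof (cases "d dvd j")
        case True
        then have "\<not> d dvd e - j" using de by (metis dvd_diff_left_iff dvd_add_left_iff diff_add_cancel)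
        then show ?thesis using Suc j by (simp add: e_def)
      qed (use first \<open>j < m\<close> in simp)
    qed
  qed (use m in \<open>auto simp: e_def\<close>)
  have em: "e - m = - 4 * int i" "e + 4 = p" by (simp_all add: e_def p_def)
  have ap: "a i $$ p = U $$ m * of_real (perturbation n m i)" using Suc by (simp add: p_def)
  have "4 * of_int e * a (Suc i) $$ e = of_int (4 * p - 8) * (of_real (critical_value n) * (U $$ m * of_real (perturbation n m i)))
      + of_int (2 * m - 16 * int i) * (U $$ m * of_real (leading n i))
      - of_int (e * (e + 1) * (e + 2) * (e + 3) * (e + 4)) * (U $$ m * of_real (perturbation n m i))"
  proof -
    have "4 * of_int e * a (Suc i) $$ e = of_int (4 * (e + 4) - 8) * (U $$ (-4) * a i $$ (e + 4))
        + of_int (4 * (e - m) + 2 * m) * (U $$ m * a i $$ (e - m))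
        - of_int (e * (e + 1) * (e + 2) * (e + 3) * (e + 4)) * a i $$ (e + 4)"
      using nth[of e] m unfolding S by simp
    then show ?thesis unfolding em ap leading \<phi> by simp
  qed
  also have "\<dots> = 4 * (U $$ m * of_real (indicial n p * perturbation n m i + (real_of_int m / 2 - 4 * real i) * leading n i))"
  proof -
    have ep: "e = p - 4" by (simp add: e_def p_def)
    show ?thesis unfolding indicial_def ep by (simp add: field_simps)
  qed
  finally have "of_int e * a (Suc i) $$ e = U $$ m * of_real (indicial n p * perturbation n m i + (real_of_int m / 2 - 4 * real i) * leading n i)"
    by simp
  moreover have "of_real (real_of_int m - 4 * real i) = (of_int e :: complex)" by (simp add: e_def)
  moreover have "perturbation n m (Suc i) = (indicial n p * perturbation n m i + (real_of_int m / 2 - 4 * real i) * leading n i) / (real_of_int m - 4 * real i)"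
    by (simp add: p_def)
  ultimately have "a (Suc i) $$ e = U $$ m * of_real (perturbation n m (Suc i))"
    using enz by (simp only: of_real_divide) (simp add: field_simps)
  moreover have "m + 4 - 4 * int (Suc i) = e" by (simp add: e_def)
  ultimately show ?case using A by (simp add: e_def)
qed

text \<open>
  Odd exponents are excluded one after the other with \<open>d = 2\<close>, then the exponents that are 2 modulo
  4 with \<open>d = 4\<close>.
\<close>
theorem lax_pole_structure:
  assumes rec: "lax_recursion U a" and fin: "\<And>i. i > g \<Longrightarrow> a i = 0"
  obtains n where "U $$ (-4) = of_real (critical_value n)"
    and "\<forall>k<0. k \<noteq> -4 \<longrightarrow> U $$ k = 0"
    and "n \<ge> 1 \<longrightarrow> (\<forall>k. odd k \<longrightarrow> U $$ k = 0)"
    and "\<forall>k<4 * int n. \<not> 4 dvd k \<longrightarrow> U $$ k = 0"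
proof -
  have fin': "a (Suc g) = 0" using fin by simp
  from lax_leading_coefficient[OF rec fin'] obtain n where n: "U $$ (-4) = of_real (critical_value n)"
    "\<And>i e. e < - 4 * int i \<Longrightarrow> a i $$ e = 0" "\<And>i. a i $$ (- 4 * int i) = of_real (leading n i)" by blast
  have Ul: "U $$ j = 0" if "j < - 4" for j using lax_pole_order_le_4[OF rec fin' that] .
  \<comment> \<open>The index \<open>max n g + 1\<close> is beyond the end of the recursion and not before the homogeneous part.\<close>
  have vanish: "U $$ m = 0" if d: "d dvd 4" "\<not> d dvd m" and m: "-4 < m"
    and first: "\<And>j. j < m \<Longrightarrow> \<not> d dvd j \<Longrightarrow> U $$ j = 0"
    and nz: "\<And>j. j \<ge> n \<Longrightarrow> perturbation n m (Suc j) \<noteq> 0" for m d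
  proof -
    have "a (Suc (max n g)) $$ (m + 4 - 4 * int (Suc (max n g))) = U $$ m * of_real (perturbation n m (Suc (max n g)))"
      using lax_first_perturbation[OF rec fin' n d m first, of "Suc (max n g)"] by blast
    moreover have "a (Suc (max n g)) = 0" by (rule fin) simp
    ultimately show ?thesis using nz[of "max n g"] by (simp del: perturbation.simps)
  qed
  have odd0: "U $$ k = 0" if "odd k" "n \<ge> 1 \<or> k < 0" for k
    using that
  proof (induction "nat (k + 4)" arbitrary: k rule: less_induct)
    case less
    show ?case
    proof (cases "k < -4")
      case False
      then have k: "-3 \<le> k" using \<open>odd k\<close> by presburger
      show ?thesis
      proof (rule vanish[of 2])
        show "U $$ j = 0" if "j < k" "\<not> 2 dvd j" for j
        proof (cases "j < -4")
          case False
          then show ?thesis using that less.prems by (intro less.hyps) auto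
        qed (use Ul in simp)
        show "perturbation n k (Suc j) \<noteq> 0" if "j \<ge> n" for j
        proof (cases "k < 0")
          case True
          then show ?thesis using perturbation_nonzero_simple[OF k _ that] by simp
        next
          case False
          then show ?thesis using perturbation_nonzero_odd[OF _ k _ that] less.prems by simp
        qed
      qed (use k less.prems in auto)
    qed (use Ul in simp)
  qed
  have four: "U $$ k = 0" if "\<not> 4 dvd k" "k < 4 * int n \<or> k < 0" for k
    using that
  proof (induction "nat (k + 4)" arbitrary: k rule: less_induct)
    case less
    have "k \<noteq> -4" using \<open>\<not> 4 dvd k\<close> by auto
    then consider "k < -4" | "odd k" | "-3 \<le> k" "even k" by linarith
    then show ?case
    proof cases
      case 2
      then show ?thesis using odd0[of k] less.prems by (cases n) auto
    next
      case 3
      show ?thesis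
      proof (rule vanish[of 4])
        show "U $$ j = 0" if "j < k" "\<not> 4 dvd j" for j
        proof (cases "j < -4")
          case False
          then show ?thesis using that less.prems by (intro less.hyps) auto
        qed (use Ul in simp)
        show "perturbation n k (Suc j) \<noteq> 0" if "j \<ge> n" for j
        proof (rule perturbation_nonzero_simple[OF 3(1) _ that])
          show "k < 0 \<or> (\<exists>l\<ge>1. l \<le> n \<and> k = 4 * int l - 2)"
          proof (cases "k < 0")
            case False
            have "\<exists>l. k = 4 * l - 2" using \<open>even k\<close> \<open>\<not> 4 dvd k\<close> by presburger
            then obtain l where l: "k = 4 * l - 2" by blast
            then have "1 \<le> nat l" "nat l \<le> n" "k = 4 * int (nat l) - 2" using False less.prems by auto
            then show ?thesis by blast
          qed simp
        qed
      qed (use 3 less.prems in auto)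
    qed (use Ul in simp)
  qed
  have neg: "U $$ k = 0" if "k < 0" "k \<noteq> -4" for k
  proof (cases "k < -4")
    case False
    then have "\<not> 4 dvd k" using that by presburger
    then show ?thesis using four that by simp
  qed (use Ul in simp)
  show ?thesis
    by (rule that[OF n(1)]) (use neg odd0 four in auto)
qed

section \<open>Operators with Laurent series coefficients\<close>

definition poly_deriv :: "complex fls poly \<Rightarrow> complex fls poly" where
  "poly_deriv = map_poly fls_deriv"

lemma coeff_poly_deriv [simp]: "coeff (poly_deriv P) i = fls_deriv (coeff P i)"
  by (simp add: poly_deriv_def coeff_map_poly)

lemma coeff_poly_deriv_funpow: "coeff ((poly_deriv ^^ k) P) i = (fls_deriv ^^ k) (coeff P i)"
  by (induction k) auto

lemma fls_deriv_sum: "fls_deriv (\<Sum>i\<in>A. f i) = (\<Sum>i\<in>A. fls_deriv (f i))"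
  by (induction A rule: infinite_finite_induct) auto

lemma poly_deriv_add [simp]: "poly_deriv (P + Q) = poly_deriv P + poly_deriv Q"
  and poly_deriv_diff [simp]: "poly_deriv (P - Q) = poly_deriv P - poly_deriv Q"
  and poly_deriv_0 [simp]: "poly_deriv 0 = 0"
  by (auto intro!: poly_eqI)

lemma poly_deriv_mult [simp]: "poly_deriv (P * Q) = P * poly_deriv Q + poly_deriv P * Q"
  by (rule poly_eqI) (simp add: coeff_mult fls_deriv_sum sum.distrib)

lemma poly_deriv_pCons [simp]: "poly_deriv (pCons c P) = pCons (fls_deriv c) (poly_deriv P)"
  by (rule poly_eqI) (auto simp: coeff_pCons split: nat.splits)

lemma poly_deriv_smult [simp]: "poly_deriv (smult c P) = smult (fls_deriv c) P + smult c (poly_deriv P)"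
  by (rule poly_eqI) simp

lemma poly_deriv_1 [simp]: "poly_deriv 1 = 0"
  by (simp add: one_pCons)

lemma poly_deriv_numeral [simp]: "poly_deriv (numeral n) = 0"
  by (simp add: numeral_poly)

text \<open>
  A module over the differential operators with Laurent series coefficients. An operator is
  represented by the polynomial whose \<open>i\<close>-th coefficient stands in front of \<open>D\<^sup>i\<close>.
\<close>
locale differential_module =
  fixes smul :: "complex fls \<Rightarrow> 'v::ab_group_add \<Rightarrow> 'v" and D :: "'v \<Rightarrow> 'v"
  assumes smul_add_left: "smul (a + b) v = smul a v + smul b v"
    and smul_add_right: "smul a (v + w) = smul a v + smul a w"
    and smul_mult: "smul (a * b) v = smul a (smul b v)"
    and D_add: "D (v + w) = D v + D w"
    and D_smul: "D (smul a v) = smul (fls_deriv a) v + smul a (D v)"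
begin

definition act :: "complex fls poly \<Rightarrow> 'v \<Rightarrow> 'v" where
  "act P v = (\<Sum>i\<le>degree P. smul (coeff P i) ((D ^^ i) v))"

lemma smul_0_left [simp]: "smul 0 v = 0" using smul_add_left[of 0 0 v] by simp
lemma smul_0_right [simp]: "smul a 0 = 0" using smul_add_right[of a 0 0] by simp
lemma D_0 [simp]: "D 0 = 0" using D_add[of 0 0] by simp

lemma D_sum: "D (\<Sum>i\<in>A. f i) = (\<Sum>i\<in>A. D (f i))"
  by (induction A rule: infinite_finite_induct) (auto simp: D_add)

lemma smul_sum: "smul a (\<Sum>i\<in>A. f i) = (\<Sum>i\<in>A. smul a (f i))"
  by (induction A rule: infinite_finite_induct) (auto simp: smul_add_right)

lemma act_eq_sum: "degree P \<le> n \<Longrightarrow> act P v = (\<Sum>i\<le>n. smul (coeff P i) ((D ^^ i) v))"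
  unfolding act_def by (rule sum.mono_neutral_left) (auto simp: coeff_eq_0)

lemma act_0 [simp]: "act 0 v = 0" by (simp add: act_def)

lemma act_add: "act (P + Q) v = act P v + act Q v"
  unfolding act_eq_sum[of "P + Q" "max (degree P) (degree Q)", OF degree_add_le_max]
    act_eq_sum[of P "max (degree P) (degree Q)", OF max.cobounded1] 
    act_eq_sum[of Q "max (degree P) (degree Q)", OF max.cobounded2]
  by (simp add: smul_add_left sum.distrib)

lemma act_sum: "act (\<Sum>i\<in>A. f i) v = (\<Sum>i\<in>A. act (f i) v)"
  by (induction A rule: infinite_finite_induct) (auto simp: act_add)

lemma act_smult: "act (smult c P) v = smul c (act P v)"
  unfolding act_eq_sum[OF degree_smult_le[of c P]] unfolding act_def smul_sum by (simp add: smul_mult)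

lemma act_pCons: "act (pCons 0 P) v = (\<Sum>i\<le>degree P. smul (coeff P i) ((D ^^ Suc i) v))"
proof -
  have "act (pCons 0 P) v = (\<Sum>i\<le>Suc (degree P). smul (coeff (pCons 0 P) i) ((D ^^ i) v))"
    by (rule act_eq_sum) (rule degree_pCons_le)
  then show ?thesis by (simp only: sum.atMost_Suc_shift) simp
qed

end

text \<open>Composition of an operator with the derivation from the left: \<open>D P = P D + P'\<close>.\<close>
definition op_deriv :: "complex fls poly \<Rightarrow> complex fls poly" where
  "op_deriv P = pCons 0 P + poly_deriv P"

definition op_comp :: "complex fls poly \<Rightarrow> complex fls poly \<Rightarrow> complex fls poly" where
  "op_comp P Q = (\<Sum>i\<le>degree P. smult (coeff P i) ((op_deriv ^^ i) Q))"

context differential_module begin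

lemma act_op_deriv: "act (op_deriv P) v = D (act P v)"
proof -
  have "degree (poly_deriv P) \<le> degree P" by (rule degree_le) (auto simp: coeff_eq_0)
  then have "act (poly_deriv P) v = (\<Sum>i\<le>degree P. smul (fls_deriv (coeff P i)) ((D ^^ i) v))"
    by (simp add: act_eq_sum)
  then show ?thesis unfolding op_deriv_def act_add act_pCons
    by (simp add: act_def D_sum D_smul sum.distrib)
qed

lemma act_op_comp: "act (op_comp P Q) v = act P (act Q v)"
proof -
  have "act ((op_deriv ^^ i) Q) v = (D ^^ i) (act Q v)" for i
    by (induction i) (auto simp: act_op_deriv)
  then show ?thesis by (simp add: op_comp_def act_sum act_smult act_def[of P])
qed

end

interpretation fls: differential_module "(*)" fls_deriv
  by unfold_locales (auto simp: algebra_simps)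

lemma fls_deriv_funpow_X_power: "(fls_deriv ^^ i) (fls_X ^ j) = (if i \<le> j then of_nat (\<Prod>l<i. j - l) * fls_X ^ (j - i) else (0 :: complex fls))"
proof (induction i)
  case (Suc i)
  have c: "fls_deriv (of_nat m * f) = of_nat m * fls_deriv f" for m and f :: "complex fls"
    by simp
  show ?case
  proof (cases "i \<le> j")
    case True
    then have "(fls_deriv ^^ Suc i) (fls_X ^ j) = of_nat (\<Prod>l<i. j - l) * (of_nat (j - i) * fls_X ^ (j - i - 1) :: complex fls)"
      using Suc by (simp del: of_nat_prod of_nat_diff add: fls_deriv_X_power)
    then show ?thesis using True by (cases "i = j") (auto simp: mult.assoc simp del: of_nat_diff of_nat_prod)
  qed (use Suc in simp)
qed simp

text \<open>If the coefficients below \<open>j\<close> vanish, then \<open>E\<close> maps \<open>X\<^sup>j\<close> to \<open>j!\<close> times the coefficient at \<open>j\<close>.\<close>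
lemma op_eq_0I:
  assumes "\<And>j. fls.act E (fls_X ^ j) = 0"
  shows "E = 0"
proof (rule poly_eqI)
  fix j show "coeff E j = coeff 0 j"
  proof (induction j rule: less_induct)
    case (less j)
    define N where "N = max j (degree E)"
    have "0 = fls.act E (fls_X ^ j)" using assms by simp
    also have "\<dots> = (\<Sum>i\<le>N. coeff E i * (fls_deriv ^^ i) (fls_X ^ j))"
      by (rule fls.act_eq_sum) (simp add: N_def)
    also have "\<dots> = (\<Sum>i\<in>{j}. coeff E i * (fls_deriv ^^ i) (fls_X ^ j))"
      by (rule sum.mono_neutral_right) (use less in \<open>auto simp: N_def fls_deriv_funpow_X_power not_le neq_iff\<close>)
    also have "\<dots> = coeff E j * of_nat (\<Prod>l<j. j - l)"
      by (simp add: fls_deriv_funpow_X_power)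
    finally show ?case by (auto simp del: of_nat_prod of_nat_diff simp: of_nat_eq_0_iff)
  qed
qed

lemma op_comp_commuteI:
  assumes "\<And>j. fls.act P (fls.act Q (fls_X ^ j)) = fls.act Q (fls.act P (fls_X ^ j))"
  shows "op_comp P Q = op_comp Q P"
proof -
  have "fls.act (op_comp P Q - op_comp Q P) (fls_X ^ j) = 0" for j
  proof -
    have "fls.act (op_comp P Q - op_comp Q P) (fls_X ^ j) + fls.act (op_comp Q P) (fls_X ^ j) = fls.act (op_comp P Q) (fls_X ^ j)"
      by (simp flip: fls.act_add)
    then show ?thesis using assms by (simp add: fls.act_op_comp)
  qed
  then show ?thesis using op_eq_0I by fastforce
qed

text \<open>
  A tuple \<open>(v\<^sub>0, v\<^sub>1, v\<^sub>2, v\<^sub>3)\<close> stands for \<open>v\<^sub>0 \<psi> + v\<^sub>1 \<psi>' + v\<^sub>2 \<psi>'' + v\<^sub>3 \<psi>'''\<close>, where \<open>\<psi>\<close> is a formal solution of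
  \<open>\<psi>'''' + U \<psi> = z \<psi>\<close> and the coefficients are polynomials in \<open>z\<close>. Such formal solutions take the
  place of a fundamental system of solutions that depends on the parameter \<open>z\<close>.
\<close>
type_synonym eigen_module = "complex fls poly \<times> complex fls poly \<times> complex fls poly \<times> complex fls poly"

definition em_smul :: "complex fls \<Rightarrow> eigen_module \<Rightarrow> eigen_module" where
  "em_smul c = (\<lambda>(v0, v1, v2, v3). ([:c:] * v0, [:c:] * v1, [:c:] * v2, [:c:] * v3))"

definition em_deriv :: "complex fls \<Rightarrow> eigen_module \<Rightarrow> eigen_module" where
  "em_deriv U = (\<lambda>(v0, v1, v2, v3). (poly_deriv v0 + ([:0, 1:] - [:U:]) * v3, poly_deriv v1 + v0, poly_deriv v2 + v1, poly_deriv v3 + v2))"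

definition em_z :: "eigen_module \<Rightarrow> eigen_module" where
  "em_z = (\<lambda>(v0, v1, v2, v3). ([:0, 1:] * v0, [:0, 1:] * v1, [:0, 1:] * v2, [:0, 1:] * v3))"

lemma differential_module_em: "differential_module em_smul (em_deriv U)"
proof
  fix a b :: "complex fls" and v w :: eigen_module
  show "em_smul (a + b) v = em_smul a v + em_smul b v"
    by (cases v) (simp add: em_smul_def smult_add_left)
  show "em_smul a (v + w) = em_smul a v + em_smul a w"
    by (cases v, cases w) (simp add: em_smul_def smult_add_right)
  show "em_smul (a * b) v = em_smul a (em_smul b v)"
    by (cases v) (simp add: em_smul_def)
  show "em_deriv U (v + w) = em_deriv U v + em_deriv U w"
    by (cases v, cases w) (simp add: em_deriv_def smult_add_right algebra_simps)
  show "em_deriv U (em_smul a v) = em_smul (fls_deriv a) v + em_smul a (em_deriv U v)"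
    by (cases v) (simp add: em_smul_def em_deriv_def smult_add_right smult_diff_right algebra_simps)
qed

text \<open>
  The hypothesis is that the tuple is an eigenvector of \<open>D\<^sup>4 + U\<close> with eigenvalue \<open>z\<close>. Its components
  at \<open>\<psi>'\<close>, \<open>\<psi>''\<close> and \<open>\<psi>'''\<close> are the equations \<open>E1\<close>, \<open>E2\<close> and \<open>E3\<close> of the proof. From
  \<open>2 E1 - 2 E2' + E3''\<close> all terms with \<open>b\<^sub>0\<close> and \<open>b\<^sub>1\<close> cancel.
\<close>
lemma lax_equation_of_eigenvector:
  assumes w: "em_smul U (b0, b1, b2, b3) + (em_deriv U ^^ 4) (b0, b1, b2, b3) = em_z (b0, b1, b2, b3)"
  defines "Q \<equiv> 2 * b2 + poly_deriv b3"
  shows "(poly_deriv ^^ 5) Q + 4 * ([:0, 1:] - [:U:]) * poly_deriv Q - 2 * [:fls_deriv U:] * Q = 0"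
proof -
  define z u u1 u2 where "z = [:0, 1 :: complex fls:]" and "u = [:U:]" and "u1 = [:fls_deriv U:]"
    and "u2 = [:fls_deriv (fls_deriv U):]"
  have d: "poly_deriv z = 0" "poly_deriv u = u1" "poly_deriv u1 = u2"
    by (simp_all add: z_def u_def u1_def u2_def)
  define \<delta> where "\<delta> = poly_deriv"
  have "(em_deriv U ^^ 4) v = em_deriv U (em_deriv U (em_deriv U (em_deriv U v)))" for v
    by (simp add: eval_nat_numeral)
  note w' = w[unfolded this, unfolded em_smul_def em_deriv_def em_z_def, folded z_def u_def]
  have E3: "4 * \<delta> b0 + 6 * \<delta> (\<delta> b1) + 4 * \<delta> (\<delta> (\<delta> b2)) + \<delta> (\<delta> (\<delta> (\<delta> b3))) = 0" (is "?E3 = 0")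
    using w' by (simp add: d \<delta>_def algebra_simps)
  have E2: "6 * \<delta> (\<delta> b0) + 4 * \<delta> (\<delta> (\<delta> b1)) + \<delta> (\<delta> (\<delta> (\<delta> b2))) + 4 * (z - u) * \<delta> b3 - 3 * u1 * b3 = 0" (is "?E2 = 0")
    using w' by (simp add: d \<delta>_def algebra_simps)
  have E1: "4 * \<delta> (\<delta> (\<delta> b0)) + \<delta> (\<delta> (\<delta> (\<delta> b1))) + 4 * (z - u) * \<delta> b2 + 6 * (z - u) * \<delta> (\<delta> b3)
      - 2 * u1 * b2 - 8 * u1 * \<delta> b3 - 3 * u2 * b3 = 0" (is "?E1 = 0")
    using w' by (simp add: d \<delta>_def algebra_simps)
  have "(poly_deriv ^^ 5) Q + 4 * (z - u) * poly_deriv Q - 2 * u1 * Q =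
      2 * ?E1 - 2 * \<delta> ?E2 + \<delta> (\<delta> ?E3)"
  proof -
    have five: "(poly_deriv ^^ 5) v = poly_deriv (poly_deriv (poly_deriv (poly_deriv (poly_deriv v))))" for v
      by (simp add: eval_nat_numeral)
    show ?thesis unfolding Q_def five \<delta>_def by (simp add: d algebra_simps)
  qed
  moreover have "\<dots> = 0" unfolding E1 E2 E3 by (simp add: \<delta>_def)
  ultimately show ?thesis by (simp add: z_def u_def u1_def)
qed


definition em_one :: eigen_module where "em_one = (1, 0, 0, 0)"

text \<open>
  Give \<open>z\<close> weight 4 and \<open>\<psi>\<^sup>(\<^sup>j\<^sup>)\<close> weight \<open>j\<close>. Then \<open>\<psi>\<^sup>(\<^sup>i\<^sup>)\<close> is a monomial of weight \<open>i\<close> plus terms of lower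
  weight. This gives the degree in \<open>z\<close> and the leading coefficient of \<open>Q\<close>.
\<close>
lemma em_deriv_funpow_coeffs:
  assumes "(em_deriv U ^^ i) em_one = (v0, v1, v2, v3)"
  shows "(4 * d > i \<longrightarrow> coeff v0 d = 0) \<and> (4 * d = i \<longrightarrow> coeff v0 d = 1) \<and>
    (4 * d + 1 > i \<longrightarrow> coeff v1 d = 0) \<and> (4 * d + 1 = i \<longrightarrow> coeff v1 d = 1) \<and>
    (4 * d + 2 > i \<longrightarrow> coeff v2 d = 0) \<and> (4 * d + 2 = i \<longrightarrow> coeff v2 d = 1) \<and>
    (4 * d + 3 > i \<longrightarrow> coeff v3 d = 0) \<and> (4 * d + 3 = i \<longrightarrow> coeff v3 d = 1)"
  using assms
proof (induction i arbitrary: v0 v1 v2 v3 d)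
  case 0
  then show ?case by (auto simp: em_one_def)
next
  case (Suc i)
  obtain w0 w1 w2 w3 where w: "(em_deriv U ^^ i) em_one = (w0, w1, w2, w3)" by (metis prod_cases4)
  note IH = Suc.IH[OF w]
  have v: "v0 = poly_deriv w0 + (pCons 0 w3 - smult U w3)" "v1 = poly_deriv w1 + w0" "v2 = poly_deriv w2 + w1" "v3 = poly_deriv w3 + w2"
    using Suc.prems w by (auto simp: em_deriv_def left_diff_distrib)
  have 0: "(4 * d > Suc i \<longrightarrow> coeff v0 d = 0) \<and> (4 * d = Suc i \<longrightarrow> coeff v0 d = 1)"
    using IH[of d] IH[of "d - 1"] unfolding v by (cases d) auto
  then show ?case using IH[of d] unfolding v(2-4) by auto
qed

text \<open>
  Multiplication by \<open>z\<close> commutes with all operators, and \<open>\<psi>\<close> is an eigenvector of \<open>L\<close>. So \<open>M \<psi>\<close> is one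
  too.
\<close>
theorem lax_recursion_of_commuting:
  assumes deg: "degree M = 4 * g + 2"
    and comm: "op_comp [:U, 0, 0, 0, 1:] M = op_comp M [:U, 0, 0, 0, 1:]"
  obtains a where "lax_recursion U a" "\<And>i. i > g \<Longrightarrow> a i = 0"
proof -
  interpret em: differential_module em_smul "em_deriv U" by (rule differential_module_em)
  define L where "L = [:U, 0, 0, 0, 1:]"
  have actL: "em.act L v = em_smul U v + (em_deriv U ^^ 4) v" for v
  proof -
    have "em_smul 1 w = w" for w by (cases w) (simp add: em_smul_def)
    then show ?thesis unfolding em.act_def L_def by (simp add: eval_nat_numeral)
  qed
  have Lone: "em.act L em_one = em_z em_one"
    unfolding actL by (simp add: eval_nat_numeral em_one_def em_deriv_def em_smul_def em_z_def one_pCons)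
  have z_add: "em_z (v + w) = em_z v + em_z w" for v w by (cases v, cases w) (simp add: em_z_def)
  have z_0: "em_z 0 = 0" by (simp add: em_z_def zero_prod_def)
  have z_smul: "em_z (em_smul c v) = em_smul c (em_z v)" for c v
    by (cases v) (simp add: em_z_def em_smul_def)
  have z_D: "em_z (em_deriv U v) = em_deriv U (em_z v)" for v
    by (cases v) (simp add: em_z_def em_deriv_def algebra_simps)
  have z_sum: "em_z (\<Sum>i\<in>A. f i) = (\<Sum>i\<in>A. em_z (f i))" for A :: "nat set" and f
    by (induction A rule: infinite_finite_induct) (auto simp: z_0 z_add)
  have z_Dn: "em_z ((em_deriv U ^^ i) v) = (em_deriv U ^^ i) (em_z v)" for i v
    by (induction i) (auto simp: z_D)
  have z_act: "em.act M (em_z v) = em_z (em.act M v)" for v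
    unfolding em.act_def z_sum by (simp add: z_smul z_Dn)
  obtain b0 b1 b2 b3 where b: "em.act M em_one = (b0, b1, b2, b3)" by (metis prod_cases4)
  have "em.act L (em.act M em_one) = em.act M (em.act L em_one)"
    using comm by (simp add: L_def flip: em.act_op_comp)
  also have "\<dots> = em_z (em.act M em_one)" unfolding Lone z_act ..
  finally have eig: "em_smul U (b0, b1, b2, b3) + (em_deriv U ^^ 4) (b0, b1, b2, b3) = em_z (b0, b1, b2, b3)"
    unfolding actL b .
  define Q where "Q = 2 * b2 + poly_deriv b3"
  have eq: "(poly_deriv ^^ 5) Q + 4 * ([:0, 1:] - [:U:]) * poly_deriv Q - 2 * [:fls_deriv U:] * Q = 0"
    unfolding Q_def by (rule lax_equation_of_eigenvector[OF eig])
  have eqc: "(fls_deriv ^^ 5) (coeff Q d) + 4 * (if d = 0 then 0 else fls_deriv (coeff Q (d - 1)))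
      - 4 * U * fls_deriv (coeff Q d) - 2 * fls_deriv U * coeff Q d = 0" for d
  proof -
    have "(poly_deriv ^^ 5) Q + smult 4 (pCons 0 (poly_deriv Q)) - smult (4 * U) (poly_deriv Q) - smult (2 * fls_deriv U) Q = 0"
      using eq by (simp add: algebra_simps numeral_poly)
    then have "coeff ((poly_deriv ^^ 5) Q + smult 4 (pCons 0 (poly_deriv Q)) - smult (4 * U) (poly_deriv Q) - smult (2 * fls_deriv U) Q) d = 0"
      by simp
    then show ?thesis by (cases d) (simp_all add: coeff_poly_deriv_funpow)
  qed
  define c where "c = lead_coeff M"
  have "M \<noteq> 0" using deg by auto
  then have cnz: "c \<noteq> 0" unfolding c_def by (rule leading_coeff_neq_0)
  have comps: "coeff b2 d = (\<Sum>i\<le>4*g+2. coeff M i * coeff (fst (snd (snd ((em_deriv U ^^ i) em_one)))) d)"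
    "coeff b3 d = (\<Sum>i\<le>4*g+2. coeff M i * coeff (snd (snd (snd ((em_deriv U ^^ i) em_one)))) d)" for d
  proof -
    have s: "fst (snd (snd (\<Sum>i\<in>A. f i))) = (\<Sum>i\<in>A. fst (snd (snd (f i))))"
      "snd (snd (snd (\<Sum>i\<in>A. f i))) = (\<Sum>i\<in>A. snd (snd (snd (f i))))" for A :: "nat set" and f :: "nat \<Rightarrow> eigen_module"
      by (induction A rule: infinite_finite_induct) auto
    have t: "fst (snd (snd (em_smul c v))) = smult c (fst (snd (snd v)))" "snd (snd (snd (em_smul c v))) = smult c (snd (snd (snd v)))" for c v
      by (cases v; simp add: em_smul_def)+
    have "b2 = fst (snd (snd (em.act M em_one)))" "b3 = snd (snd (snd (em.act M em_one)))" by (simp_all add: b)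
    then show "coeff b2 d = (\<Sum>i\<le>4*g+2. coeff M i * coeff (fst (snd (snd ((em_deriv U ^^ i) em_one)))) d)"
      "coeff b3 d = (\<Sum>i\<le>4*g+2. coeff M i * coeff (snd (snd (snd ((em_deriv U ^^ i) em_one)))) d)"
      unfolding em.act_def s t deg by (simp_all add: coeff_sum)
  qed
  have D2: "coeff (fst (snd (snd ((em_deriv U ^^ i) em_one)))) d = 0" if "4 * d + 2 > i" for i d
    by (cases "(em_deriv U ^^ i) em_one") (use that em_deriv_funpow_coeffs[of i U _ _ _ _ d] in auto)
  have D2': "coeff (fst (snd (snd ((em_deriv U ^^ (4 * d + 2)) em_one)))) d = 1" for d
    by (cases "(em_deriv U ^^ (4 * d + 2)) em_one") (use em_deriv_funpow_coeffs[of "4 * d + 2" U _ _ _ _ d] in \<open>auto simp del: funpow.simps\<close>)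
  have D3: "coeff (snd (snd (snd ((em_deriv U ^^ i) em_one)))) d = 0" if "4 * d + 3 > i" for i d
    by (cases "(em_deriv U ^^ i) em_one") (use that em_deriv_funpow_coeffs[of i U _ _ _ _ d] in auto)
  \<comment> \<open>Only \<open>\<partial>\<^sup>4\<^sup>g\<^sup>+\<^sup>2\<close> has enough weight for \<open>z\<^sup>g\<close> in \<open>b\<^sub>2\<close>; for \<open>z\<^sup>g\<close> in \<open>b\<^sub>3\<close> the weight \<open>4g + 3\<close> is required.\<close>
  have b3: "coeff b3 d = 0" if "d \<ge> g" for d
    unfolding comps by (rule sum.neutral) (use that in \<open>auto simp: D3\<close>)
  have b2: "coeff b2 d = 0" if "d > g" for d
    unfolding comps by (rule sum.neutral) (use that in \<open>auto simp: D2\<close>)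
  have b2g: "coeff b2 g = c"
  proof -
    have "coeff b2 g = (\<Sum>i\<in>{4*g+2}. coeff M i * coeff (fst (snd (snd ((em_deriv U ^^ i) em_one)))) g)"
      unfolding comps by (rule sum.mono_neutral_right) (auto simp: D2)
    then show ?thesis by (simp only: D2' c_def deg sum.insert finite.emptyI empty_iff sum.empty not_False_eq_True mult_1_right add_0_right)
  qed
  have two: "coeff (2 * p) d = 2 * coeff p d" for p :: "complex fls poly" and d
    by (simp add: numeral_poly)
  have Qg: "coeff Q g = 2 * c" "\<And>d. d > g \<Longrightarrow> coeff Q d = 0"
    unfolding Q_def using b2g b2 b3 by (simp_all add: two)
  \<comment> \<open>At \<open>z\<^sup>g\<^sup>+\<^sup>1\<close> the equation for \<open>Q\<close> says that the leading coefficient is constant.\<close>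
  have "fls_deriv c = 0" using eqc[of "Suc g"] Qg by (simp add: eval_nat_numeral)
  then obtain k where k: "c = fls_const k" unfolding fls_deriv_eq_0_iff by blast
  then have "k \<noteq> 0" using cnz by auto
  define e where "e = fls_const (1 / (2 * k))"
  have e0: "fls_deriv e = 0" by (simp add: e_def)
  have e: "fls_deriv (e * f) = e * fls_deriv f" for f by (simp add: e0)
  have e5: "(fls_deriv ^^ 5) (e * f) = e * (fls_deriv ^^ 5) f" for f by (simp add: eval_nat_numeral e0)
  define a where "a = (\<lambda>i. if i \<le> g then e * coeff Q (g - i) else 0)"
  have "a 0 = 1" using \<open>k \<noteq> 0\<close> by (simp add: a_def e_def Qg k flip: fls_const_numeral) 
  moreover have "4 * fls_deriv (a (Suc i)) = 4 * U * fls_deriv (a i) + 2 * fls_deriv U * a i - (fls_deriv ^^ 5) (a i)" for i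
  proof (cases "i \<le> g")
    case True
    have "a i = e * coeff Q (g - i)" using True by (simp add: a_def)
    moreover have "fls_deriv (a (Suc i)) = e * (if g - i = 0 then 0 else fls_deriv (coeff Q (g - i - 1)))"
      using True by (auto simp: a_def e0)
    ultimately have "4 * U * fls_deriv (a i) + 2 * fls_deriv U * a i - (fls_deriv ^^ 5) (a i) - 4 * fls_deriv (a (Suc i))
       = - e * ((fls_deriv ^^ 5) (coeff Q (g - i)) + 4 * (if g - i = 0 then 0 else fls_deriv (coeff Q (g - i - 1)))
         - 4 * U * fls_deriv (coeff Q (g - i)) - 2 * fls_deriv U * coeff Q (g - i))"
      by (simp only: e e5) (simp only: ring_distribs mult_ac, simp)
    also have "\<dots> = 0" unfolding eqc by simp
    finally show ?thesis by (simp add: algebra_simps)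
  next
    case False
    then show ?thesis by (simp add: a_def eval_nat_numeral)
  qed
  ultimately have "lax_recursion U a" by (simp add: lax_recursion_def)
  then show ?thesis using that[of a] by (simp add: a_def)
qed

section \<open>Laurent expansion of commuting operators\<close>

lemma laurent_expansion_of_meromorphic:
  assumes "f nicely_meromorphic_on UNIV"
  shows "(\<lambda>x. f (a + x)) has_laurent_expansion laurent_expansion f a"
proof -
  obtain F where "(\<lambda>x. f (a + x)) has_laurent_expansion F"
    using assms unfolding nicely_meromorphic_on_def meromorphic_on_def by blast
  then show ?thesis using laurent_expansion_eqI by metis
qed

lemma laurent_expansion_nonzero:
  assumes f: "f nicely_meromorphic_on UNIV" and nz: "f \<noteq> (\<lambda>_. 0)"
  shows "laurent_expansion f a \<noteq> 0"
proof
  assume "laurent_expansion f a = 0"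
  then have ev: "eventually (\<lambda>x. f x = 0) (at a)"
    using has_laurent_expansion_eventually_zero_iff[OF laurent_expansion_of_meromorphic[OF f, of a]] by simp
  have "\<forall>\<^sub>\<approx>x\<in>UNIV. f x \<noteq> 0"
    using nicely_meromorphic_imp_constant_or_avoid[OF f, of 0] nz by auto
  then have "eventually (\<lambda>x. f x \<noteq> 0) (at a)"
    by (simp add: eventually_cosparse_open_eq)
  with ev have "eventually (\<lambda>x. False) (at a)" by eventually_elim auto
  then show False by simp
qed

lemma eventually_regular_points:
  assumes "diff_op_of_order P n"
  shows "eventually (\<lambda>x. x \<in> regular_points P) (at a)"
proof -
  have c: "c nicely_meromorphic_on UNIV" if "c \<in> set P" for c
    using assms that by (simp add: diff_op_of_order_def)
  have "P \<noteq> []" "last P \<noteq> (\<lambda>_. 0)" using assms by (auto simp: diff_op_of_order_def)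
  then have "last P \<in> set P" "laurent_expansion (last P) a \<noteq> 0"
    using laurent_expansion_nonzero[OF c, of "last P"] by simp_all
  then have "eventually (\<lambda>x. last P x \<noteq> 0) (at a)"
    using has_laurent_expansion_frequently_zero_iff[OF laurent_expansion_of_meromorphic[OF c, of "last P" a]]
    by (simp add: frequently_def)
  moreover have "eventually (\<lambda>x. \<forall>c\<in>set P. \<not> is_pole c x) (at a)"
  proof (rule eventually_ball_finite)
    show "\<forall>c\<in>set P. eventually (\<lambda>x. \<not> is_pole c x) (at a)"
    proof
      fix f assume "f \<in> set P"
      then have "isolated_singularity_at f a"
        using has_laurent_expansion_isolated[where f = f and z = a] laurent_expansion_of_meromorphic[OF c, of f a] by blast
      then show "eventually (\<lambda>x. \<not> is_pole f x) (at a)" by (rule eventually_not_pole)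
    qed
  qed simp
  ultimately show ?thesis unfolding regular_points_def by eventually_elim auto
qed

lemma deriv_shift: "deriv (\<lambda>x. f (a + x)) = (\<lambda>x. deriv f (a + x))"
  unfolding deriv_def by (intro ext arg_cong[of _ _ Eps]) (simp add: DERIV_shift add.commute)

lemma has_laurent_expansion_deriv_funpow:
  assumes "(\<lambda>x. f (a + x)) has_laurent_expansion F"
  shows "(\<lambda>x. (deriv ^^ k) f (a + x)) has_laurent_expansion (fls_deriv ^^ k) F"
proof (induction k)
  case (Suc k)
  then show ?case using has_laurent_expansion_deriv[OF Suc] by (simp add: deriv_shift)
qed (use assms in simp)

definition op_expansion :: "diff_op \<Rightarrow> complex \<Rightarrow> complex fls poly" where
  "op_expansion P a = Poly (map (\<lambda>c. laurent_expansion c a) P)"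

lemma has_laurent_expansion_diff_op_apply:
  assumes P: "\<And>c. c \<in> set P \<Longrightarrow> c nicely_meromorphic_on UNIV"
    and f: "(\<lambda>x. f (a + x)) has_laurent_expansion F"
  shows "(\<lambda>x. diff_op_apply P f (a + x)) has_laurent_expansion fls.act (op_expansion P a) F"
proof -
  have "fls.act (op_expansion P a) F = (\<Sum>i\<le>length P. coeff (op_expansion P a) i * (fls_deriv ^^ i) F)"
    by (rule fls.act_eq_sum) (use degree_Poly[of "map (\<lambda>c. laurent_expansion c a) P"] in \<open>simp add: op_expansion_def\<close>)
  also have "\<dots> = (\<Sum>i<length P. laurent_expansion (P ! i) a * (fls_deriv ^^ i) F)"
    unfolding lessThan_Suc_atMost[symmetric] sum.lessThan_Suc
    by (simp add: op_expansion_def nth_default_def)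
  finally have act: "fls.act (op_expansion P a) F = \<dots>" .
  show ?thesis unfolding act diff_op_apply_def
    by (intro has_laurent_expansion_sum has_laurent_expansion_mult laurent_expansion_of_meromorphic
        has_laurent_expansion_deriv_funpow f) (simp add: P)
qed

text \<open>
  The operators are compared on the polynomials \<open>(x - a)\<^sup>j\<close> in a punctured disc of regular points.
\<close>
lemma op_expansion_commute:
  assumes L: "diff_op_of_order L l" and M: "diff_op_of_order M m" and comm: "diff_op_commute L M"
  shows "op_comp (op_expansion L a) (op_expansion M a) = op_comp (op_expansion M a) (op_expansion L a)"
proof (rule op_comp_commuteI)
  fix j
  define f where "f = (\<lambda>x. (x - a) ^ j)"
  have f: "(\<lambda>x. f (a + x)) has_laurent_expansion fls_X ^ j"
    unfolding f_def by (auto intro!: laurent_expansion_intros)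
  have nm: "c nicely_meromorphic_on UNIV" if "c \<in> set L \<or> c \<in> set M" for c
    using that L M by (auto simp: diff_op_of_order_def)
  have ex: "(\<lambda>x. diff_op_apply L (diff_op_apply M f) (a + x)) has_laurent_expansion
        fls.act (op_expansion L a) (fls.act (op_expansion M a) (fls_X ^ j))"
    "(\<lambda>x. diff_op_apply M (diff_op_apply L f) (a + x)) has_laurent_expansion
        fls.act (op_expansion M a) (fls.act (op_expansion L a) (fls_X ^ j))"
    by (intro has_laurent_expansion_diff_op_apply f nm; simp)+
  have "eventually (\<lambda>x. x \<in> regular_points L \<inter> regular_points M) (at a)"
    using eventually_regular_points[OF L, of a] eventually_regular_points[OF M, of a] by eventually_elim auto
  then obtain e where e: "e > 0" "\<And>x. x \<noteq> a \<Longrightarrow> dist x a < e \<Longrightarrow> x \<in> regular_points L \<inter> regular_points M"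
    unfolding eventually_at by blast
  have "diff_op_apply L (diff_op_apply M f) x = diff_op_apply M (diff_op_apply L f) x"
    if "x \<in> ball a e - {a}" for x
  proof -
    have "open (ball a e - {a})" by (intro open_Diff) auto
    moreover have "ball a e - {a} \<subseteq> regular_points L \<inter> regular_points M"
      using e(2) by (force simp: dist_commute)
    moreover have "f holomorphic_on (ball a e - {a})" unfolding f_def by (intro holomorphic_intros)
    ultimately show ?thesis using comm that unfolding diff_op_commute_def op_eq_on_def by blast
  qed
  then have "eventually (\<lambda>x. diff_op_apply L (diff_op_apply M f) x = diff_op_apply M (diff_op_apply L f) x) (at a)"
    unfolding eventually_at using e(1) by (intro exI[of _ e]) (auto simp: dist_commute)
  then show "fls.act (op_expansion L a) (fls.act (op_expansion M a) (fls_X ^ j)) =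
      fls.act (op_expansion M a) (fls.act (op_expansion L a) (fls_X ^ j))"
    using ex has_laurent_expansion_cong'[OF _ refl refl] has_laurent_expansion_unique by metis
qed

theorem lax_recursion_at:
  assumes u: "u nicely_meromorphic_on UNIV" and M: "diff_op_of_order M (4 * g + 2)"
    and comm: "diff_op_commute (L4 u) M"
  obtains s where "lax_recursion (laurent_expansion u a) s" "\<And>i. i > g \<Longrightarrow> s i = 0"
proof -
  have const: "laurent_expansion (\<lambda>_. c) a = fls_const c" for c
    by (rule laurent_expansion_eqI) simp
  have L: "op_expansion (L4 u) a = [:laurent_expansion u a, 0, 0, 0, 1:]"
    by (simp add: op_expansion_def L4_def const)
  have "degree (op_expansion M a) = 4 * g + 2"
  proof (rule antisym)
    have len: "length M = 4 * g + 3" using M by (simp add: diff_op_of_order_def)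
    show "degree (op_expansion M a) \<le> 4 * g + 2"
      by (rule degree_le) (auto simp: op_expansion_def nth_default_def len)
    have "M ! (4 * g + 2) = last M" using len by (subst last_conv_nth) auto
    moreover have "last M \<in> set M" using len by (intro last_in_set) auto
    then have "laurent_expansion (last M) a \<noteq> 0"
      using M by (intro laurent_expansion_nonzero) (auto simp: diff_op_of_order_def)
    ultimately have "coeff (op_expansion M a) (4 * g + 2) \<noteq> 0"
      by (simp add: op_expansion_def nth_default_def len)
    then show "4 * g + 2 \<le> degree (op_expansion M a)" by (rule le_degree)
  qed
  then show ?thesis
    using lax_recursion_of_commuting[of "op_expansion M a" g "laurent_expansion u a"]
      op_expansion_commute[OF diff_op_of_order_L4[OF u] M comm, of a] that unfolding L by blast
qed

section \<open>The first integral and the behaviour at infinity\<close>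

text \<open>
  The generating series \<open>\<Sum> a\<^sub>i X\<^sup>i\<close> is the expansion of \<open>Q / z\<^sup>g\<close> in powers of \<open>X = 1/z\<close>; \<open>x\<close>-derivatives
  act on its coefficients.
\<close>
definition fps_coeff_deriv :: "complex fls fps \<Rightarrow> complex fls fps" where
  "fps_coeff_deriv F = Abs_fps (\<lambda>n. fls_deriv (fps_nth F n))"

lemma fps_coeff_deriv_nth [simp]: "fps_nth (fps_coeff_deriv F) n = fls_deriv (fps_nth F n)"
  by (simp add: fps_coeff_deriv_def)

lemma fps_coeff_deriv_simps [simp]:
  "fps_coeff_deriv (F + G) = fps_coeff_deriv F + fps_coeff_deriv G"
  "fps_coeff_deriv (F - G) = fps_coeff_deriv F - fps_coeff_deriv G"
  "fps_coeff_deriv (F * G) = F * fps_coeff_deriv G + fps_coeff_deriv F * G"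
  "fps_coeff_deriv (fps_const c) = fps_const (fls_deriv c)"
  by (auto intro!: fps_ext simp: fps_mult_nth fls_deriv_sum sum.distrib)

lemma fps_coeff_deriv_X [simp]: "fps_coeff_deriv fps_X = 0"
  and fps_coeff_deriv_numeral [simp]: "fps_coeff_deriv (numeral k) = 0"
  by (auto intro!: fps_ext simp: fps_X_def numeral_fps_const)

text \<open>
  The part of the first integral without the factor \<open>z\<close>, with opposite sign and as a bilinear form.
  The derivation \<open>d\<close> is a parameter because it is \<open>d/dx\<close> in the local coordinate at a finite point
  and \<open>-t\<^sup>2 d/dt\<close> in the coordinate \<open>t = 1/x\<close> at infinity.
\<close>
definition energy_form :: "('a::comm_ring_1 \<Rightarrow> 'a) \<Rightarrow> 'a \<Rightarrow> 'a \<Rightarrow> 'a \<Rightarrow> 'a" where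
  "energy_form d U f h = 4 * U * f * h - d (d f) * d (d h) + 2 * d f * d (d (d h)) - 2 * f * d (d (d (d h)))"

text \<open>
  With \<open>A = \<Sum> a\<^sub>i X\<^sup>i\<close> these are the coefficients of \<open>4 A\<^sup>2 - X (4 u A\<^sup>2 - A''\<^sup>2 + 2 A' A''' - 2 A A'''')\<close>, whose
  derivative is \<open>2 A\<close> times the recursion.
\<close>
lemma lax_first_integral:
  assumes rec: "lax_recursion U a"
  obtains c where "4 * (\<Sum>i\<le>k. a i * a (k - i)) - (\<Sum>i<k. energy_form fls_deriv U (a i) (a (k - 1 - i))) = fls_const c"
proof -
  let ?d = fps_coeff_deriv
  define A where "A = Abs_fps a"
  define u u1 where "u = fps_const U" and "u1 = fps_const (fls_deriv U)"
  define E where "E = 4 * u * A * A - ?d (?d A) * ?d (?d A) + 2 * ?d A * ?d (?d (?d A)) - 2 * A * ?d (?d (?d (?d A)))"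
  have du: "?d u = u1" by (simp add: u_def u1_def)
  have lax: "4 * ?d A = fps_X * (4 * u * ?d A + 2 * u1 * A - ?d (?d (?d (?d (?d A)))))"
  proof (rule fps_ext)
    fix n
    show "fps_nth (4 * ?d A) n = fps_nth (fps_X * (4 * u * ?d A + 2 * u1 * A - ?d (?d (?d (?d (?d A)))))) n"
    proof (cases n)
      case 0
      then show ?thesis using rec by (simp add: A_def lax_recursion_def numeral_fps_const)
    next
      case (Suc i)
      have "4 * fls_deriv (a (Suc i)) = 4 * U * fls_deriv (a i) + 2 * fls_deriv U * a i - (fls_deriv ^^ 5) (a i)"
        using rec by (simp add: lax_recursion_def)
      then show ?thesis using Suc by (simp add: A_def u_def u1_def numeral_fps_const eval_nat_numeral mult.assoc)
    qed
  qed
  have "?d (4 * A * A - fps_X * E) = 2 * A * (4 * ?d A - fps_X * (4 * u * ?d A + 2 * u1 * A - ?d (?d (?d (?d (?d A))))))"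
    unfolding E_def by (simp add: du algebra_simps)
  also have "\<dots> = 0" using lax by simp
  finally have "fls_deriv (fps_nth (4 * A * A - fps_X * E) k) = 0"
    by (metis fps_coeff_deriv_nth fps_zero_nth)
  then obtain c where "fps_nth (4 * A * A - fps_X * E) k = fls_const c"
    unfolding fls_deriv_eq_0_iff by blast
  moreover have "fps_nth (4 * A * A - fps_X * E) k = 4 * (\<Sum>i\<le>k. a i * a (k - i)) - (\<Sum>i<k. energy_form fls_deriv U (a i) (a (k - 1 - i)))"
  proof -
    have 1: "fps_nth (4 * A * A) k = 4 * (\<Sum>i\<le>k. a i * a (k - i))"
      by (simp only: mult.assoc numeral_fps_const fps_mult_left_const_nth) (simp add: fps_mult_nth A_def atLeast0AtMost)
    have 2: "fps_nth (fps_X * E) k = (\<Sum>i<k. energy_form fls_deriv U (a i) (a (k - 1 - i)))"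
    proof (cases k)
      case (Suc n)
      have "fps_nth E n = (\<Sum>i\<le>n. energy_form fls_deriv U (a i) (a (n - i)))"
        unfolding E_def energy_form_def
        by (simp only: mult.assoc numeral_fps_const u_def fps_mult_left_const_nth fps_add_nth fps_sub_nth)
          (simp add: fps_mult_nth A_def atLeast0AtMost sum.distrib sum_subtractf sum_distrib_left mult.assoc)
      then show ?thesis using Suc by (simp add: lessThan_Suc_atMost)
    qed simp
    show ?thesis using 1 2 by simp
  qed
  ultimately show ?thesis using that by metis
qed

text \<open>
  \<open>p\<close> and \<open>q\<close> are the expansions at \<open>b\<close> and at infinity of one function. The relation is compatible with the
  ring operations and with differentiation, and thus carries differential polynomials in \<open>u\<close> from \<open>b\<close>
  to infinity.
\<close>
definition continues :: "real \<Rightarrow> complex \<Rightarrow> complex fls \<Rightarrow> complex fls \<Rightarrow> bool" where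
  "continues R b p q \<longleftrightarrow> (\<exists>h. h holomorphic_on {x. norm x > R} \<and>
     (\<lambda>x. h (b + x)) has_laurent_expansion p \<and> (\<lambda>t. h (inverse t)) has_laurent_expansion q)"

definition deriv_at_inf :: "complex fls \<Rightarrow> complex fls" where
  "deriv_at_inf q = - fls_shift (-2) (fls_deriv q)"

lemma deriv_at_inf_nth: "deriv_at_inf q $$ j = - of_int (j - 1) * q $$ (j - 1)"
  by (simp add: deriv_at_inf_def algebra_simps)

lemma open_outside: "open {x :: complex. norm x > R}"
  by (intro open_Collect_less continuous_intros)

lemma continues_const: "continues R b (fls_const c) (fls_const c)"
  unfolding continues_def by (intro exI[of _ "\<lambda>_. c"]) auto

lemma continues_add: "continues R b p q \<Longrightarrow> continues R b p' q' \<Longrightarrow> continues R b (p + p') (q + q')"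
  unfolding continues_def
proof (elim exE conjE, goal_cases)
  case (1 h h')
  then show ?case by (intro exI[of _ "\<lambda>x. h x + h' x"]) (auto intro!: holomorphic_intros laurent_expansion_intros)
qed

lemma continues_diff: "continues R b p q \<Longrightarrow> continues R b p' q' \<Longrightarrow> continues R b (p - p') (q - q')"
  unfolding continues_def
proof (elim exE conjE, goal_cases)
  case (1 h h')
  then show ?case by (intro exI[of _ "\<lambda>x. h x - h' x"]) (auto intro!: holomorphic_intros laurent_expansion_intros)
qed

lemma continues_mult: "continues R b p q \<Longrightarrow> continues R b p' q' \<Longrightarrow> continues R b (p * p') (q * q')"
  unfolding continues_def
proof (elim exE conjE, goal_cases)
  case (1 h h')
  then show ?case by (intro exI[of _ "\<lambda>x. h x * h' x"]) (auto intro!: holomorphic_intros laurent_expansion_intros)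
qed

lemma continues_sum: "(\<And>i. i \<in> A \<Longrightarrow> continues R b (p i) (q i)) \<Longrightarrow> continues R b (\<Sum>i\<in>A. p i) (\<Sum>i\<in>A. q i)"
  using continues_const[of R b 0] by (induction A rule: infinite_finite_induct) (auto intro: continues_add)

lemma eventually_inverse_outside: "eventually (\<lambda>t. norm (inverse t) > R \<and> t \<noteq> 0) (at (0::complex))"
proof -
  have "eventually (\<lambda>t. t \<in> ball 0 (1 / (\<bar>R\<bar> + 1)) - {0}) (at (0::complex))"
    by (intro eventually_at_in_open) auto
  then show ?thesis
  proof eventually_elim
    case (elim t)
    then have "norm t > 0" "norm t < 1 / (\<bar>R\<bar> + 1)" by auto
    then have "\<bar>R\<bar> + 1 < 1 / norm t" by (simp add: field_simps)
    then show ?case using elim by (auto simp: norm_inverse divide_inverse)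
  qed
qed

lemma continues_deriv:
  assumes "continues R b p q"
  shows "continues R b (fls_deriv p) (deriv_at_inf q)"
proof -
  obtain h where h: "h holomorphic_on {x. norm x > R}" "(\<lambda>x. h (b + x)) has_laurent_expansion p" "(\<lambda>t. h (inverse t)) has_laurent_expansion q"
    using assms unfolding continues_def by blast
  have "deriv h holomorphic_on {x. norm x > R}" by (rule holomorphic_deriv[OF h(1) open_outside])
  moreover have "(\<lambda>x. deriv h (b + x)) has_laurent_expansion fls_deriv p"
    using has_laurent_expansion_deriv[OF h(2)] by (simp add: deriv_shift)
  moreover have "(\<lambda>t. deriv h (inverse t)) has_laurent_expansion deriv_at_inf q"
  proof -
    have "(\<lambda>t. - (deriv (\<lambda>t. h (inverse t)) t * t powi 2)) has_laurent_expansion - fls_shift (-2) (fls_deriv q)"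
      by (intro has_laurent_expansion_minus has_laurent_expansion_shift has_laurent_expansion_deriv h)
    also have "?this \<longleftrightarrow> ?thesis"
      unfolding deriv_at_inf_def
    proof (intro has_laurent_expansion_cong refl)
      show "eventually (\<lambda>t. - (deriv (\<lambda>t. h (inverse t)) t * t powi 2) = deriv h (inverse t)) (at 0)"
        using eventually_inverse_outside[of R]
      proof eventually_elim
        case (elim t)
        then have "(h has_field_derivative deriv h (inverse t)) (at (inverse t))"
          using h(1) open_outside by (intro holomorphic_derivI[of _ "{x. norm x > R}"]) auto
        then have "((\<lambda>t. h (inverse t)) has_field_derivative deriv h (inverse t) * (- (inverse t * 1 * inverse t))) (at t)"
          by (rule DERIV_chain2) (use elim in \<open>auto intro!: derivative_eq_intros\<close>)
        then have "deriv (\<lambda>t. h (inverse t)) t = deriv h (inverse t) * (- (inverse t * 1 * inverse t))"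
          by (rule DERIV_imp_deriv)
        then show ?case using elim by (simp add: power2_eq_square field_simps)
      qed
    qed
    finally show ?thesis .
  qed
  ultimately show ?thesis unfolding continues_def by blast
qed

text \<open>The identity theorem on the connected set \<open>norm x > R\<close>.\<close>
lemma continues_const_unique:
  assumes "continues R b (fls_const c) q" "R < norm b"
  shows "q = fls_const c"
proof -
  define S where "S = {x :: complex. norm x > R}"
  obtain h where h: "h holomorphic_on S" "(\<lambda>x. h (b + x)) has_laurent_expansion fls_const c" "(\<lambda>t. h (inverse t)) has_laurent_expansion q"
    using assms(1) unfolding continues_def S_def by blast
  have "S = - cball 0 R" by (auto simp: S_def)
  then have conn: "connected S" "open S"
    using connected_complement_bounded_convex[of "cball (0::complex) R"] by auto
  define A where "A = (\<lambda>x. x - b) ` S"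
  have A: "open A" "connected A" "0 \<in> A" 
    using conn assms(2) open_translation_subtract[of S b] unfolding A_def
    by (auto intro!: connected_continuous_image continuous_intros simp: S_def)
  have eq: "h x = c" if "x \<in> S - {b}" for x
  proof -
    have "(\<lambda>x. h (b + x) - c) has_laurent_expansion fls_const c - fls_const c"
      by (intro laurent_expansion_intros h)
    then have "(\<lambda>x. h (b + x) - c) has_laurent_expansion 0" by simp
    moreover have "(\<lambda>x. h (b + x) - c) holomorphic_on A - {0}"
    proof (rule holomorphic_on_subset)
      show "(\<lambda>x. h (b + x) - c) holomorphic_on A"
        by (intro holomorphic_intros holomorphic_on_compose_gen[OF _ h(1), unfolded o_def]) (auto simp: A_def)
    qed auto
    ultimately have "h (b + (x - b)) - c = 0"
      by (rule has_laurent_expansion_0_analytic_continuation[OF _ _ A]) (use that in \<open>auto simp: A_def\<close>)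
    then show ?thesis by simp
  qed
  have "eventually (\<lambda>t. h (inverse t) = c) (at 0)"
    using eventually_inverse_outside[of "max R (norm b)"]
    by eventually_elim (rule eq, auto simp: S_def)
  then have "((\<lambda>t. h (inverse t)) has_laurent_expansion q) \<longleftrightarrow> ((\<lambda>t. c) has_laurent_expansion q)"
    by (intro has_laurent_expansion_cong) auto
  then show ?thesis using h(3) has_laurent_expansion_unique[of "\<lambda>_. c" q "fls_const c"] by auto
qed

text \<open>The coefficients of \<open>(1 - y)\<^sup>-\<^sup>1\<^sup>/\<^sup>2\<close>.\<close>
definition central_coeff :: "nat \<Rightarrow> real" where
  "central_coeff k = (-1) ^ k * ((-1/2) gchoose k)"

lemma central_coeff_0 [simp]: "central_coeff 0 = 1" by (simp add: central_coeff_def)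

lemma central_coeff_nonzero: "central_coeff k \<noteq> 0"
  unfolding central_coeff_def gbinomial_prod_rev by (auto simp: field_simps)

text \<open>Coefficients of \<open>(1 - y)\<^sup>-\<^sup>1\<^sup>/\<^sup>2 \<cdot> (1 - y)\<^sup>-\<^sup>1\<^sup>/\<^sup>2 = (1 - y)\<^sup>-\<^sup>1\<close>.\<close>
lemma central_coeff_convolution: "(\<Sum>i\<le>k. central_coeff i * central_coeff (k - i)) = 1"
proof -
  have "(\<Sum>i\<le>k. central_coeff i * central_coeff (k - i)) = (\<Sum>i\<le>k. (-1) ^ k * (((-1/2) gchoose i) * ((-1/2) gchoose (k - i))))"
    by (intro sum.cong refl) (simp add: central_coeff_def power_add[symmetric] mult_ac)
  also have "\<dots> = (-1) ^ k * ((-1) gchoose k)"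
    using gbinomial_Vandermonde[of "-1/2 :: real" "-1/2" k] by (simp add: sum_distrib_left[symmetric] atLeast0AtMost)
  also have "\<dots> = 1"
    using gbinomial_minus[of "1 :: real" k] by (simp add: power_mult_distrib[symmetric] binomial_gbinomial[symmetric])
  finally show ?thesis .
qed

lemma order_mult:
  fixes f h :: "complex fls"
  assumes "\<And>j. j < s \<Longrightarrow> f $$ j = 0" "\<And>j. j < t \<Longrightarrow> h $$ j = 0"
  shows "j < s + t \<Longrightarrow> (f * h) $$ j = 0" "(f * h) $$ (s + t) = f $$ s * h $$ t"
  using fls_times_nth_bounded[of s f t h] assms by auto


text \<open>At infinity each derivative raises the order in \<open>t\<close>, so only the term without derivatives contributes.\<close>
lemma energy_form_nth:
  assumes U: "\<And>j. j < - n \<Longrightarrow> U $$ j = 0" and f: "\<And>j. j < s \<Longrightarrow> f $$ j = 0" and h: "\<And>j. j < t \<Longrightarrow> h $$ j = 0"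
    and n: "n > 0"
  shows "j < s + t - n \<Longrightarrow> energy_form deriv_at_inf U f h $$ j = 0"
    and "energy_form deriv_at_inf U f h $$ (s + t - n) = 4 * U $$ (- n) * f $$ s * h $$ t"
proof -
  define rest where "rest = energy_form deriv_at_inf U f h - 4 * (U * (f * h))"
  have d': "deriv_at_inf q $$ j = 0" if "\<And>j. j < r \<Longrightarrow> q $$ j = 0" "j < r" for q r j
    using that by (simp add: deriv_at_inf_nth)
  have "(deriv_at_inf (deriv_at_inf f) * deriv_at_inf (deriv_at_inf h)) $$ j = 0"
    "(deriv_at_inf f * deriv_at_inf (deriv_at_inf (deriv_at_inf h))) $$ j = 0"
    "(f * deriv_at_inf (deriv_at_inf (deriv_at_inf (deriv_at_inf h)))) $$ j = 0" if "j < s + t" for j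
    by (rule order_mult(1)[of s _ t]; use that in \<open>auto intro!: d' f h\<close>)+
  then have rest: "rest $$ j = 0" if "j < s + t" for j
    using that by (simp add: rest_def energy_form_def mult.assoc)
  have e: "energy_form deriv_at_inf U f h = 4 * (U * (f * h)) + rest" by (simp add: rest_def)
  note fh = order_mult[of s f t h, OF f h]
  note Ufh = order_mult[of "-n" U "s + t" "f * h", OF U fh(1)]
  show "j < s + t - n \<Longrightarrow> energy_form deriv_at_inf U f h $$ j = 0"
    unfolding e using n rest[of j] Ufh(1)[of j] by simp
  have "- n + (s + t) = s + t - n" by simp
  then show "energy_form deriv_at_inf U f h $$ (s + t - n) = 4 * U $$ (- n) * f $$ s * h $$ t"
    unfolding e using n rest[of "s + t - n"] Ufh(2) fh(2) by simp
qed

lemma continues_energy_form: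
  assumes "continues R b U U'" "continues R b f f'" "continues R b h h'"
  shows "continues R b (energy_form fls_deriv U f h) (energy_form deriv_at_inf U' f' h')"
  unfolding energy_form_def fls_const_numeral[symmetric]
  by (intro continues_add continues_diff continues_mult continues_const continues_deriv assms)

text \<open>
  The first integral expresses \<open>8 a\<^sub>k\<close> by \<open>a\<^sub>0, \<dots>, a\<^sub>k\<^sub>-\<^sub>1\<close> without integration. So \<open>a\<^sub>k\<close> continues to infinity
  with at most a pole there. For the leading coefficients it reads \<open>(1 - y) \<gamma>\<^sup>2 = 1\<close> with the
  generating function \<open>\<gamma>\<close>.
\<close>
lemma lax_growth_at_infinity:
  assumes rec: "lax_recursion U a" and U: "continues R b U V" 
    and n: "n > 0" and V: "\<And>j. j < - n \<Longrightarrow> V $$ j = 0"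
  shows "\<exists>q. continues R b (a k) q \<and> (\<forall>j < - n * int k. q $$ j = 0) \<and>
     q $$ (- n * int k) = of_real (central_coeff k) * (V $$ (- n)) ^ k"
proof (induction k rule: less_induct)
  case (less k)
  show ?case
  proof (cases "k = 0")
    case True
    then show ?thesis using rec continues_const[of R b 1]
      by (intro exI[of _ 1]) (auto simp: lax_recursion_def)
  next
    case False
    define \<phi> where "\<phi> = V $$ (- n)"
    have "\<forall>i\<in>{..<k}. \<exists>q. continues R b (a i) q \<and> (\<forall>j < - n * int i. q $$ j = 0) \<and> q $$ (- n * int i) = of_real (central_coeff i) * \<phi> ^ i"
      using less.IH by (auto simp: \<phi>_def)
    then obtain q where q: "\<And>i. i < k \<Longrightarrow> continues R b (a i) (q i)" "\<And>i j. i < k \<Longrightarrow> j < - n * int i \<Longrightarrow> q i $$ j = 0"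
      "\<And>i. i < k \<Longrightarrow> q i $$ (- n * int i) = of_real (central_coeff i) * \<phi> ^ i"
      by (auto dest!: bchoice)
    obtain c where c: "4 * (\<Sum>i\<le>k. a i * a (k - i)) - (\<Sum>i<k. energy_form fls_deriv U (a i) (a (k - 1 - i))) = fls_const c"
      using lax_first_integral[OF rec] by blast
    have split: "(\<Sum>i\<le>k. f i) = f 0 + f k + (\<Sum>i\<in>{0<..<k}. f i)" for f :: "nat \<Rightarrow> 'x::comm_monoid_add"
    proof -
      have "{..k} = insert 0 (insert k {0<..<k})" using False by auto
      then show ?thesis using False by (simp add: add.assoc)
    qed
    have a0: "a 0 = 1" using rec by (simp add: lax_recursion_def)
    have "8 * a k = fls_const c - 4 * (\<Sum>i\<in>{0<..<k}. a i * a (k - i)) + (\<Sum>i<k. energy_form fls_deriv U (a i) (a (k - 1 - i)))"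
      using c unfolding split by (simp add: a0 algebra_simps)
    then have "fls_const (1/8) * (8 * a k) = fls_const (1/8) * (fls_const c - fls_const 4 * (\<Sum>i\<in>{0<..<k}. a i * a (k - i)) + (\<Sum>i<k. energy_form fls_deriv U (a i) (a (k - 1 - i))))"
      by simp
    moreover have "fls_const (1/8) * (8 * a k) = a k"
      by (simp add: mult.assoc[symmetric] flip: fls_const_numeral)
    ultimately have ak: "a k = fls_const (1/8) * (fls_const c - fls_const 4 * (\<Sum>i\<in>{0<..<k}. a i * a (k - i)) + (\<Sum>i<k. energy_form fls_deriv U (a i) (a (k - 1 - i))))"
      by simp
    \<comment> \<open>The same formula at infinity.\<close>
    define Q where "Q = fls_const (1/8) * (fls_const c - fls_const 4 * (\<Sum>i\<in>{0<..<k}. q i * q (k - i)) + (\<Sum>i<k. energy_form deriv_at_inf V (q i) (q (k - 1 - i))))"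
    have cont: "continues R b (a k) Q"
      unfolding ak Q_def
      by (intro continues_add continues_diff continues_mult continues_sum continues_const continues_energy_form U q) auto
    have prod: "(q i * q (k - i)) $$ j = 0" "(q i * q (k - i)) $$ (- n * int k) = of_real (central_coeff i * central_coeff (k - i)) * \<phi> ^ k"
      if "i \<in> {0<..<k}" "j < - n * int k" for i j
    proof -
      have e: "- n * int i + - n * int (k - i) = - n * int k" using that by (simp add: of_nat_diff algebra_simps)
      note om = order_mult[of "- n * int i" "q i" "- n * int (k - i)" "q (k - i)", OF q(2) q(2), unfolded e]
      show "(q i * q (k - i)) $$ j = 0" using om(1)[of j] that by simp
      have "\<phi> ^ i * \<phi> ^ (k - i) = \<phi> ^ k" using that by (simp flip: power_add)
      then show "(q i * q (k - i)) $$ (- n * int k) = of_real (central_coeff i * central_coeff (k - i)) * \<phi> ^ k"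
        using om(2) that q(3)[of i] q(3)[of "k - i"] by (simp add: mult_ac)
    qed
    have form: "energy_form deriv_at_inf V (q i) (q (k - 1 - i)) $$ j = 0"
       "energy_form deriv_at_inf V (q i) (q (k - 1 - i)) $$ (- n * int k) = 4 * of_real (central_coeff i * central_coeff (k - 1 - i)) * \<phi> ^ k"
      if "i < k" "j < - n * int k" for i j
    proof -
      have e: "- n * int i + - n * int (k - 1 - i) - n = - n * int k" using that by (simp add: of_nat_diff algebra_simps)
      have l: "k - 1 - i < k" using that by simp
      note ef = energy_form_nth[of n V "- n * int i" "q i" "- n * int (k - 1 - i)" "q (k - 1 - i)", OF V q(2)[OF that(1)] q(2)[OF l] n, unfolded e]
      show "energy_form deriv_at_inf V (q i) (q (k - 1 - i)) $$ j = 0" using ef(1) that by simp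
      have "\<phi> * \<phi> ^ i * \<phi> ^ (k - 1 - i) = \<phi> ^ Suc (i + (k - 1 - i))" by (simp add: power_add)
      also have "Suc (i + (k - 1 - i)) = k" using that by simp
      finally have p: "\<phi> * \<phi> ^ i * \<phi> ^ (k - 1 - i) = \<phi> ^ k" .
      have "energy_form deriv_at_inf V (q i) (q (k - 1 - i)) $$ (- n * int k) =
          4 * \<phi> * (of_real (central_coeff i) * \<phi> ^ i) * (of_real (central_coeff (k - 1 - i)) * \<phi> ^ (k - 1 - i))"
        using ef(2) unfolding q(3)[OF that(1)] q(3)[OF l] \<phi>_def .
      then show "energy_form deriv_at_inf V (q i) (q (k - 1 - i)) $$ (- n * int k) = 4 * of_real (central_coeff i * central_coeff (k - 1 - i)) * \<phi> ^ k"
        unfolding p[symmetric] by (simp only: of_real_mult mult_ac)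
    qed
    have sum_nth: "(\<Sum>i\<in>A. f i) $$ j = (\<Sum>i\<in>A. f i $$ j)" for A :: "nat set" and f :: "nat \<Rightarrow> complex fls" and j
      by (induction A rule: infinite_finite_induct) auto
    have neg: "- n * int k < 0" using n False by simp
    have low: "Q $$ j = 0" if "j < - n * int k" for j
      using that neg prod(1) form(1) by (simp add: Q_def sum_nth fls_const_nth)
    have "Q $$ (- n * int k) = (1/8) * (- 4 * (\<Sum>i\<in>{0<..<k}. of_real (central_coeff i * central_coeff (k - i)) * \<phi> ^ k)
        + (\<Sum>i<k. 4 * of_real (central_coeff i * central_coeff (k - 1 - i)) * \<phi> ^ k))"
    proof -
      have "- n * int k - 1 < - n * int k" by simp
      note p = prod(2)[OF _ this] and f = form(2)[OF _ this]
      have 1: "(\<Sum>i\<in>{0<..<k}. q i * q (k - i)) $$ (- n * int k) = (\<Sum>i\<in>{0<..<k}. of_real (central_coeff i * central_coeff (k - i)) * \<phi> ^ k)"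
        unfolding sum_nth by (intro sum.cong refl) (rule p)
      have 2: "(\<Sum>i<k. energy_form deriv_at_inf V (q i) (q (k - 1 - i))) $$ (- n * int k) = (\<Sum>i<k. 4 * of_real (central_coeff i * central_coeff (k - 1 - i)) * \<phi> ^ k)"
        unfolding sum_nth by (intro sum.cong refl) (rule f, simp)
      have 3: "fls_const c $$ (- n * int k) = 0" using neg by (auto simp: fls_const_nth)
      show ?thesis unfolding Q_def by (simp only: fls_mult_const_nth fls_plus_nth fls_minus_nth 1 2 3) simp
    qed
    also have "\<dots> = (1/8) * of_real (- 4 * (\<Sum>i\<in>{0<..<k}. central_coeff i * central_coeff (k - i)) + 4 * (\<Sum>i<k. central_coeff i * central_coeff (k - 1 - i))) * \<phi> ^ k"
      by (simp add: sum_distrib_left sum_distrib_right algebra_simps)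
    also have "(\<Sum>i<k. central_coeff i * central_coeff (k - 1 - i)) = 1"
    proof -
      have "{..<k} = {..k - 1}" using False by auto
      then show ?thesis using central_coeff_convolution[of "k - 1"] by simp
    qed
    also have "(\<Sum>i\<in>{0<..<k}. central_coeff i * central_coeff (k - i)) = 1 - 2 * central_coeff k"
      using central_coeff_convolution[of k] unfolding split by simp
    finally have "Q $$ (- n * int k) = of_real (central_coeff k) * \<phi> ^ k" by (simp add: algebra_simps)
    then show ?thesis using cont low unfolding \<phi>_def by blast
  qed
qed

text \<open>
  In degree \<open>2g + 1\<close> all products \<open>a\<^sub>i a\<^sub>j\<close> vanish and the first integral reduces to the form of \<open>a\<^sub>g\<close> with
  itself, which would have a pole at infinity.
\<close>
theorem not_pole_at_infinity:
  assumes rec: "lax_recursion U a" and fin: "\<And>i. i > g \<Longrightarrow> a i = 0"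
    and U: "continues R b U V" "R < norm b"
  shows "fls_subdegree V \<ge> 0"
proof (rule ccontr)
  assume neg: "\<not> fls_subdegree V \<ge> 0"
  define n where "n = - fls_subdegree V"
  have n: "n > 0" using neg by (simp add: n_def)
  have "V \<noteq> 0" using neg by auto
  then have Vn: "V $$ (- n) \<noteq> 0" by (simp add: n_def)
  have Vlow: "V $$ j = 0" if "j < - n" for j using that by (simp add: n_def)
  obtain q where q: "continues R b (a g) q" "\<And>j. j < - n * int g \<Longrightarrow> q $$ j = 0"
     "q $$ (- n * int g) = of_real (central_coeff g) * (V $$ (- n)) ^ g"
    using lax_growth_at_infinity[OF rec U(1) n Vlow, of g] by blast
  obtain c where c: "4 * (\<Sum>i\<le>2*g+1. a i * a (2*g+1 - i)) - (\<Sum>i<2*g+1. energy_form fls_deriv U (a i) (a (2*g+1 - 1 - i))) = fls_const c"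
    using lax_first_integral[OF rec] by blast
  have "(\<Sum>i\<le>2*g+1. a i * a (2*g+1 - i)) = 0"
  proof (intro sum.neutral ballI)
    fix i
    have "i > g \<or> 2*g+1 - i > g" by auto
    then show "a i * a (2*g+1 - i) = 0" using fin by auto
  qed
  moreover have "(\<Sum>i<2*g+1. energy_form fls_deriv U (a i) (a (2*g+1 - 1 - i))) = (\<Sum>i\<in>{g}. energy_form fls_deriv U (a i) (a (2*g+1 - 1 - i)))"
  proof (rule sum.mono_neutral_right)
    show "\<forall>i\<in>{..<2*g+1} - {g}. energy_form fls_deriv U (a i) (a (2*g+1 - 1 - i)) = 0"
    proof
      fix i assume "i \<in> {..<2*g+1} - {g}"
      then have "i > g \<or> 2*g+1 - 1 - i > g" by auto
      then have "a i = 0 \<or> a (2*g+1 - 1 - i) = 0" using fin by auto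
      then show "energy_form fls_deriv U (a i) (a (2*g+1 - 1 - i)) = 0" by (auto simp: energy_form_def)
    qed
  qed auto
  ultimately have "- energy_form fls_deriv U (a g) (a g) = fls_const c"
    using c by (simp add: mult_2)
  then have "energy_form fls_deriv U (a g) (a g) = - fls_const c" by (metis add.inverse_inverse)
  then have "energy_form fls_deriv U (a g) (a g) = fls_const (- c)" by simp
  then have "energy_form deriv_at_inf V q q = fls_const (- c)"
    using continues_energy_form[OF U(1) q(1) q(1)] U(2) continues_const_unique by metis
  moreover have "energy_form deriv_at_inf V q q $$ (- n * int g + - n * int g - n) = 4 * V $$ (- n) * q $$ (- n * int g) * q $$ (- n * int g)"
    by (rule energy_form_nth(2)[OF Vlow q(2) q(2) n])
  moreover have "- n * int g + - n * int g - n < 0"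
  proof -
    have "n * int g \<ge> 0" using n by simp
    then show ?thesis using n by linarith
  qed
  ultimately show False using Vn central_coeff_nonzero[of g] unfolding q(3) by (simp add: fls_const_nth)
qed

section \<open>The theorem\<close>

lemma isolated_singularity_inverse:
  assumes "u holomorphic_on {x. norm x > R}"
  shows "isolated_singularity_at (\<lambda>t. u (inverse t)) 0"
proof -
  obtain r where r: "r > 0"
    "\<forall>t\<in>UNIV. t \<noteq> (0::complex) \<and> dist t 0 < r \<longrightarrow> norm (inverse t) > R \<and> t \<noteq> 0"
    using eventually_inverse_outside[of R] unfolding eventually_at by (elim exE conjE)
  have "inverse holomorphic_on ball 0 r - {0::complex}"
    by (intro holomorphic_intros) auto
  moreover have "inverse ` (ball 0 r - {0::complex}) \<subseteq> {x. norm x > R}"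
    using r(2) by (auto simp: dist_commute)
  ultimately have "(u \<circ> inverse) holomorphic_on ball 0 r - {0}"
    by (rule holomorphic_on_compose_gen[OF _ assms])
  then have "(\<lambda>t. u (inverse t)) holomorphic_on ball 0 r - {0}" by (simp add: o_def)
  then have "(\<lambda>t. u (inverse t)) analytic_on ball 0 r - {0}"
    by (subst analytic_on_open) auto
  then show ?thesis using r(1) unfolding isolated_singularity_at_def by blast
qed

theorem theorem1p1:
  fixes u :: "complex \<Rightarrow> complex" and M :: diff_op and g :: nat
  assumes "u nicely_meromorphic_on UNIV"
    and "diff_op_of_order M (4 * g + 2)"
    and "diff_op_commute (L4 u) M"
    and "has_rank (L4 u) M 2"
  shows "(\<forall>a. is_pole u a \<longrightarrow> zorder u a = -4) \<and>
    (\<forall>a. is_pole u a \<longrightarrow>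
       (\<exists>n::nat. n \<ge> 1 \<and>
          laurent_coeff u a (-4) = of_nat (n * (4 * n + 1) * (4 * n + 3) * (4 * n + 4)) \<and>
          (\<forall>k\<in>{0..n}. \<forall>l\<in>{1, 2, 3}. laurent_coeff u a (4 * int k - l) = 0) \<and>
          (\<forall>r\<in>{n + 1..g}. laurent_coeff u a (4 * int r - 1) = 0 \<and>
                           laurent_coeff u a (4 * int r - 3) = 0))) \<and>
    \<not> isolated_pole_at_infinity u"
proof -
  note lax = lax_recursion_at[OF assms(1,2,3)]
  have poles: "\<exists>n. n \<ge> 1 \<and> zorder u a = -4 \<and>
      laurent_coeff u a (-4) = of_nat (n * (4 * n + 1) * (4 * n + 3) * (4 * n + 4)) \<and>
      (\<forall>k. odd k \<longrightarrow> laurent_coeff u a k = 0) \<and>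
      (\<forall>k<4 * int n. \<not> 4 dvd k \<longrightarrow> laurent_coeff u a k = 0)" if "is_pole u a" for a
  proof -
    define U where "U = laurent_expansion u a"
    have exp: "(\<lambda>x. u (a + x)) has_laurent_expansion U"
      unfolding U_def by (rule laurent_expansion_of_meromorphic[OF assms(1)])
    have neg: "fls_subdegree U < 0"
      using has_laurent_expansion_imp_is_pole_iff[OF exp] that by simp
    then have nz: "U \<noteq> 0" by auto
    obtain s where s: "lax_recursion U s" "\<And>i. i > g \<Longrightarrow> s i = 0"
      using lax[of a] unfolding U_def by blast
    obtain n where n: "U $$ (-4) = of_real (critical_value n)"
      "\<forall>k<0. k \<noteq> -4 \<longrightarrow> U $$ k = 0"
      "n \<ge> 1 \<longrightarrow> (\<forall>k. odd k \<longrightarrow> U $$ k = 0)"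
      "\<forall>k<4 * int n. \<not> 4 dvd k \<longrightarrow> U $$ k = 0"
      by (rule lax_pole_structure[OF s])
    have sub: "U $$ fls_subdegree U \<noteq> 0" using nz by simp
    then have four: "fls_subdegree U = -4" using n(2) neg by blast
    then have "critical_value n \<noteq> 0" using sub n(1) by auto
    then have "n \<ge> 1" by (cases n) (auto simp: critical_value_def)
    moreover have "zorder u a = -4" using has_laurent_expansion_zorder[OF exp nz] four by simp
    moreover have "complex_of_real (critical_value n) = of_nat (n * (4 * n + 1) * (4 * n + 3) * (4 * n + 4))"
      by (simp add: critical_value_def algebra_simps)
    ultimately show ?thesis
      using n unfolding laurent_coeff_def U_def[symmetric] by (intro exI[of _ n]) simp
  qed
  have "\<exists>n::nat. n \<ge> 1 \<and>
          laurent_coeff u a (-4) = of_nat (n * (4 * n + 1) * (4 * n + 3) * (4 * n + 4)) \<and>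
          (\<forall>k\<in>{0..n}. \<forall>l\<in>{1, 2, 3}. laurent_coeff u a (4 * int k - l) = 0) \<and>
          (\<forall>r\<in>{n + 1..g}. laurent_coeff u a (4 * int r - 1) = 0 \<and>
                           laurent_coeff u a (4 * int r - 3) = 0)" if "is_pole u a" for a
  proof -
    obtain n where n: "n \<ge> 1"
      "laurent_coeff u a (-4) = of_nat (n * (4 * n + 1) * (4 * n + 3) * (4 * n + 4))"
      "\<And>k. odd k \<Longrightarrow> laurent_coeff u a k = 0"
      "\<And>k. \<not> 4 dvd k \<Longrightarrow> k < 4 * int n \<Longrightarrow> laurent_coeff u a k = 0"
      using poles[OF \<open>is_pole u a\<close>] by blast
    have "laurent_coeff u a (4 * int k - l) = 0" if "k \<in> {0..n}" "l \<in> {1, 2, 3}" for k and l :: int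
    proof (rule n(4))
      show "\<not> 4 dvd 4 * int k - l" using that(2) by (elim insertE emptyE; simp; presburger)
      show "4 * int k - l < 4 * int n" using that by auto
    qed
    moreover have "laurent_coeff u a (4 * int r - 1) = 0" "laurent_coeff u a (4 * int r - 3) = 0" for r
      by (rule n(3); simp)+
    ultimately show ?thesis using n(1,2) by blast
  qed
  moreover have "\<not> isolated_pole_at_infinity u"
  proof
    assume "isolated_pole_at_infinity u"
    then obtain R0 where R0: "u holomorphic_on {x. norm x > R0}" and pole: "is_pole (\<lambda>t. u (inverse t)) 0"
      unfolding isolated_pole_at_infinity_def by blast
    define R where "R = max R0 0"
    define b where "b = complex_of_real (R + 1)"
    have b: "R < norm b" unfolding b_def norm_of_real by (simp add: R_def)
    have hol: "u holomorphic_on {x. norm x > R}"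
      by (rule holomorphic_on_subset[OF R0]) (auto simp: R_def)
    define V where "V = laurent_expansion (\<lambda>t. u (inverse t)) 0"
    have V: "(\<lambda>t. u (inverse t)) has_laurent_expansion V"
      unfolding V_def
      by (intro not_essential_has_laurent_expansion_0 isolated_singularity_inverse[OF hol]
          is_pole_imp_not_essential pole)
    have "continues R b (laurent_expansion u b) V"
      unfolding continues_def using hol V laurent_expansion_of_meromorphic[OF assms(1)] by blast
    moreover obtain s where "lax_recursion (laurent_expansion u b) s" "\<And>i. i > g \<Longrightarrow> s i = 0"
      using lax[of b] by blast
    ultimately have "fls_subdegree V \<ge> 0" using not_pole_at_infinity b by blast
    then show False using is_pole_0_imp_neg_fls_subdegree[OF V pole] by simp
  qed
  ultimately show ?thesis using poles by blast
qed

end
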